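(* Let $M\in{}^*\mathbb N\setminus\mathbb N$ satisfy $M\varepsilon\approx0$, and let $h:\mathbb X\to{}^*\mathbb R$ be the grid function with $h(x)=0$ for $x\le0$, $h(x)=x/(M\varepsilon)$ for $0<x<M\varepsilon$, and $h(x)=1$ for $x\ge M\varepsilon$. Then $[h\,\mathbb Dh]=\frac12H'$, where $H$ is the Heaviside function and $H'=\delta_0$ is its distributional derivative.
   Context: Work in a nonstandard extension of the standard universe; $x\approx y$ means $x-y$ is infinitesimal; ${}^\circ x$ is the standard part of a finite $x$. Fix an infinite $N_0\in{}^*\mathbb N$, let $N=N_0!$, $\varepsilon=1/N$, and $\mathbb X=\{n\varepsilon: n\in{}^*\mathbb Z,\ -N^2\le n\le N^2\}$. Grid functions are internal functions $\mathbb X\to{}^*\mathbb R$. $\mathbb Df(x)=\varepsilon^{-1}(f(x+\varepsilon)-f(x))$ is the forward difference, and $\langle f,g\rangle=\varepsilon\sum_{x\in\mathbb X}f(x)g(x)$. A test function is a grid function $\varphi$ vanishing outside $[-r,r]$ for some standard $r$ and such that, for every standard $n\ge0$, $\mathbb D^n\varphi$ is finite at finite points of $\mathbb X$ and $\mathbb D^n\varphi(x)\approx\mathbb D^n\varphi(y)$ for all finite $x\approx y$ in $\mathbb X$. For such $\varphi$, ${}^\circ\varphi\in\mathscr D(\mathbb R)$ is defined by ${}^\circ\varphi({}^\circ x)={}^\circ(\varphi(x))$. For a grid function $f$ and a distribution $T\in\mathscr D'(\mathbb R)$, $[f]=T$ means that $\langle f,\varphi\rangle$ is finite with ${}^\circ\langle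 f,\varphi\rangle=\langle T,{}^\circ\varphi\rangle$ for all test functions $\varphi$. $H(x)=0$ for $x\le0$ and $H(x)=1$ for $x>0$. *)

theory Defs
  imports "HOL-Analysis.Analysis"
begin

section \<open>Nonstandard extensions\<close>

text \<open>
  The part of the standard universe that is needed consists of the real numbers, of \<^emph>\<open>all\<close>
  functions from reals to reals, and of \<^emph>\<open>all\<close> real-valued operations taking finitely many real
  numbers and finitely many such functions as arguments.  The transfer principle is stated for the
  first-order language with two sorts of variables (numbers and functions), which has a symbol for
  each of these operations.  Sets and relations are dealt with through their indicator functions.
  For example, hyperfinite summation and the set of hypernaturals are extensions of standard
  operations.
\<close>

type_synonym 'r operation = "'r list \<Rightarrow> ('r \<Rightarrow> 'r) list \<Rightarrow> 'r"

datatype num_term =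
    Var nat
  | App nat num_term
  | Op "real operation" "num_term list" "nat list"

datatype form =
    Equal num_term num_term
  | Neg form
  | And form form
  | All_num nat form
  | All_fun nat form

text \<open>
  In \<open>App i t\<close>, \<open>Op G ts is\<close> and \<open>All_fun i\<close>, the indices \<open>i\<close> and \<open>is\<close> refer to function variables.
  The argument \<open>I\<close> interprets the operation symbols; \<open>F\<close> is the range of the function variables.
\<close>

primrec eval ::
  "(real operation \<Rightarrow> 'r operation) \<Rightarrow> (nat \<Rightarrow> 'r) \<Rightarrow> (nat \<Rightarrow> 'r \<Rightarrow> 'r) \<Rightarrow> num_term \<Rightarrow> 'r"
where
  "eval I a b (Var i) = a i"
| "eval I a b (App i t) = b i (eval I a b t)"
| "eval I a b (Op G ts is) = I G (map (eval I a b) ts) (map b is)"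

primrec sat ::
  "(real operation \<Rightarrow> 'r operation) \<Rightarrow> ('r \<Rightarrow> 'r) set \<Rightarrow>
   (nat \<Rightarrow> 'r) \<Rightarrow> (nat \<Rightarrow> 'r \<Rightarrow> 'r) \<Rightarrow> form \<Rightarrow> bool"
where
  "sat I F a b (Equal s t) \<longleftrightarrow> eval I a b s = eval I a b t"
| "sat I F a b (Neg p) \<longleftrightarrow> \<not> sat I F a b p"
| "sat I F a b (And p q) \<longleftrightarrow> sat I F a b p \<and> sat I F a b q"
| "sat I F a b (All_num i p) \<longleftrightarrow> (\<forall>x. sat I F (a(i := x)) b p)"
| "sat I F a b (All_fun i p) \<longleftrightarrow> (\<forall>f\<in>F. sat I F a (b(i := f)) p)"

text \<open>
  A type of this class is the field of hyperreals of a nonstandard extension: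
  \<open>star_op G\<close> is the extension of a standard operation \<open>G\<close>, and \<open>internal\<close> is the set of internal
  functions from hyperreals to hyperreals.  Values of \<open>star_op G\<close> at functions that are not internal
  are irrelevant.  The arithmetic and the order of the hyperreals are the extensions of those of the
  reals.  Both sides of the transfer axiom are universal closures, so the axiom is the
  transfer principle for sentences.  It does not by itself provide an infinite element.
\<close>

class nonstandard_reals = linordered_field +
  fixes star_op :: "(real list \<Rightarrow> (real \<Rightarrow> real) list \<Rightarrow> real) \<Rightarrow> 'a list \<Rightarrow> ('a \<Rightarrow> 'a) list \<Rightarrow> 'a"
    and internal :: "('a \<Rightarrow> 'a) set"
  assumes star_op_add: "star_op (\<lambda>xs _. xs ! 0 + xs ! 1) [x, y] [] = x + y"
    and star_op_mult: "star_op (\<lambda>xs _. xs ! 0 * xs ! 1) [x, y] [] = x * y"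
    and star_op_less: "star_op (\<lambda>xs _. if xs ! 0 < xs ! 1 then 1 else 0) [x, y] [] = 1 \<longleftrightarrow> x < y"
    and transfer:
    "(\<forall>a b. sat (\<lambda>G. G) UNIV a b p) \<longleftrightarrow>
     (\<forall>a b. range b \<subseteq> internal \<longrightarrow> sat star_op internal a b p)"

definition star_real :: "real \<Rightarrow> 'a::nonstandard_reals" where
  "star_real r = star_op (\<lambda>_ _. r) [] []"

definition star_fun :: "(real \<Rightarrow> real) \<Rightarrow> 'a \<Rightarrow> 'a::nonstandard_reals" where
  "star_fun f x = star_op (\<lambda>xs _. f (xs ! 0)) [x] []"

definition star_set :: "real set \<Rightarrow> 'a::nonstandard_reals set" where
  "star_set A = {x. star_fun (indicator A) x = 1}"

definition star_fact :: "'a \<Rightarrow> 'a::nonstandard_reals" where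
  "star_fact = star_fun (\<lambda>x. fact (nat \<lfloor>x\<rfloor>))"

text \<open>
  The extension of the operation mapping a function \<open>f\<close> and (the indicator function of) a finite set
  \<open>A\<close> to the sum of \<open>f\<close> over \<open>A\<close>; it is meaningful for internal \<open>f\<close> and hyperfinite \<open>A\<close>.
\<close>

definition hyperfinite_sum :: "('a \<Rightarrow> 'a) \<Rightarrow> 'a set \<Rightarrow> 'a::nonstandard_reals" where
  "hyperfinite_sum f A = star_op (\<lambda>_ fs. \<Sum>x | (fs ! 1) x = 1. (fs ! 0) x) [] [f, indicator A]"

definition hfinite :: "'a::nonstandard_reals \<Rightarrow> bool" where
  "hfinite x \<longleftrightarrow> (\<exists>r. \<bar>x\<bar> \<le> star_real r)"

definition inf_close :: "'a::nonstandard_reals \<Rightarrow> 'a \<Rightarrow> bool" where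
  "inf_close x y \<longleftrightarrow> (\<forall>r>0. \<bar>x - y\<bar> < star_real r)"

definition st_part :: "'a::nonstandard_reals \<Rightarrow> real" where
  "st_part x = (THE r. inf_close x (star_real r))"


section \<open>Grid functions\<close>

definition eps :: "'a \<Rightarrow> 'a::nonstandard_reals" where
  "eps N = 1 / N"

definition grid :: "'a \<Rightarrow> 'a::nonstandard_reals set" where
  "grid N = {n * eps N | n. n \<in> star_set \<int> \<and> - (N^2) \<le> n \<and> n \<le> N^2}"

text \<open>
  An internal function on the grid is represented by its extension by zero to all hyperreals,
  which is again internal.
\<close>

definition grid_functions :: "'a \<Rightarrow> ('a \<Rightarrow> 'a::nonstandard_reals) set" where
  "grid_functions N = {f \<in> internal. \<forall>x. x \<notin> grid N \<longrightarrow> f x = 0}"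

text \<open>
  At the right endpoint of the grid, \<open>x + eps N\<close> lies outside the grid, so \<open>f (x + eps N)\<close> is read
  as zero there.  This value is immaterial below, since test functions vanish at infinite points.
\<close>

definition grid_diff :: "'a \<Rightarrow> ('a \<Rightarrow> 'a) \<Rightarrow> 'a \<Rightarrow> 'a::nonstandard_reals" where
  "grid_diff N f x = (if x \<in> grid N then inverse (eps N) * (f (x + eps N) - f x) else 0)"

definition grid_inner :: "'a \<Rightarrow> ('a \<Rightarrow> 'a) \<Rightarrow> ('a \<Rightarrow> 'a) \<Rightarrow> 'a::nonstandard_reals" where
  "grid_inner N f g = eps N * hyperfinite_sum (\<lambda>x. f x * g x) (grid N)"

definition grid_test_functions :: "'a \<Rightarrow> ('a \<Rightarrow> 'a::nonstandard_reals) set" where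
  "grid_test_functions N = {\<phi> \<in> grid_functions N.
     (\<exists>r::real. \<forall>x\<in>grid N. x \<notin> {- star_real r..star_real r} \<longrightarrow> \<phi> x = 0) \<and>
     (\<forall>n::nat.
        (\<forall>x\<in>grid N. hfinite x \<longrightarrow> hfinite ((grid_diff N ^^ n) \<phi> x)) \<and>
        (\<forall>x\<in>grid N. \<forall>y\<in>grid N. hfinite x \<and> hfinite y \<and> inf_close x y \<longrightarrow>
           inf_close ((grid_diff N ^^ n) \<phi> x) ((grid_diff N ^^ n) \<phi> y)))}"

definition st_function :: "'a \<Rightarrow> ('a \<Rightarrow> 'a::nonstandard_reals) \<Rightarrow> real \<Rightarrow> real" where
  "st_function N \<phi> t =
     (THE s. \<exists>x\<in>grid N. hfinite x \<and> st_part x = t \<and> st_part (\<phi> x) = s)"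


section \<open>Distributions on the real line\<close>

definition test_functions :: "(real \<Rightarrow> real) set" where
  "test_functions = {\<phi>. (\<forall>n x. (deriv ^^ n) \<phi> differentiable (at x)) \<and>
                        (\<exists>r. \<forall>x. \<bar>x\<bar> > r \<longrightarrow> \<phi> x = 0)}"

definition test_converges :: "(nat \<Rightarrow> real \<Rightarrow> real) \<Rightarrow> (real \<Rightarrow> real) \<Rightarrow> bool" where
  "test_converges \<phi>s \<phi> \<longleftrightarrow>
     (\<exists>r. \<forall>k x. \<bar>x\<bar> > r \<longrightarrow> \<phi>s k x = 0) \<and>
     (\<forall>n. uniform_limit UNIV (\<lambda>k. (deriv ^^ n) (\<phi>s k)) ((deriv ^^ n) \<phi>) sequentially)"

text \<open>
  Distributions are represented by functionals on all functions, of which only the values on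
  \<open>test_functions\<close> matter.
\<close>

type_synonym functional = "(real \<Rightarrow> real) \<Rightarrow> real"

definition is_distribution :: "functional \<Rightarrow> bool" where
  "is_distribution T \<longleftrightarrow>
     (\<forall>\<phi>\<in>test_functions. \<forall>\<psi>\<in>test_functions. T (\<lambda>x. \<phi> x + \<psi> x) = T \<phi> + T \<psi>) \<and>
     (\<forall>\<phi>\<in>test_functions. \<forall>c. T (\<lambda>x. c * \<phi> x) = c * T \<phi>) \<and>
     (\<forall>\<phi>s. \<forall>\<phi>\<in>test_functions.
        (\<forall>k. \<phi>s k \<in> test_functions) \<and> test_converges \<phi>s \<phi> \<longrightarrow> (\<lambda>k. T (\<phi>s k)) \<longlonglongrightarrow> T \<phi>)"

definition regular_distribution :: "(real \<Rightarrow> real) \<Rightarrow> functional" where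
  "regular_distribution f \<phi> = (LINT x|lborel. f x * \<phi> x)"

definition dist_deriv :: "functional \<Rightarrow> functional" where
  "dist_deriv T \<phi> = - T (deriv \<phi>)"

definition dist_scale :: "real \<Rightarrow> functional \<Rightarrow> functional" where
  "dist_scale c T \<phi> = c * T \<phi>"

definition dirac :: "real \<Rightarrow> functional" where
  "dirac c \<phi> = \<phi> c"

definition dist_eq :: "functional \<Rightarrow> functional \<Rightarrow> bool" where
  "dist_eq S T \<longleftrightarrow> (\<forall>\<phi>\<in>test_functions. S \<phi> = T \<phi>)"

definition heaviside :: "real \<Rightarrow> real" where
  "heaviside x = (if x \<le> 0 then 0 else 1)"

text \<open>The relation \<open>[f] = T\<close> between a grid function and a distribution.\<close>

definition represents :: "'a::nonstandard_reals \<Rightarrow> ('a \<Rightarrow> 'a) \<Rightarrow> functional \<Rightarrow> bool" where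
  "represents N f T \<longleftrightarrow>
     f \<in> grid_functions N \<and> is_distribution T \<and>
     (\<forall>\<phi>\<in>grid_test_functions N.
        hfinite (grid_inner N f \<phi>) \<and>
        st_part (grid_inner N f \<phi>) = T (st_function N \<phi>))"

end

theory Submission
  imports Defs
begin

text \<open>
  Put \<open>x = n\<epsilon>\<close>.  For \<open>0 \<le> n < M\<close> we have \<open>h x = n/M\<close> and \<open>\<D>h x = N/M\<close>, and \<open>h \<cdot> \<D>h\<close> vanishes at
  all other points that matter, so \<open>\<langle>h \<D>h, \<phi>\<rangle> = \<Sum>n<M. (n/M\<^sup>2) \<phi>(n\<epsilon>)\<close>.  The weights add up to
  \<open>(M-1)/(2M) \<approx> 1/2\<close> and all the points lie in the monad of \<open>0\<close>, hence the sum is infinitely close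
  to \<open>\<phi>(0)/2\<close>.

  It remains to see that \<open>H'\<close> takes the value \<open>\<psi>(0)\<close> at \<open>\<psi> = st \<phi>\<close>.  By the fundamental theorem of calculus
  this only needs \<open>\<psi>\<close> to be continuously differentiable with compact support.  Its derivative is the
  standard part of \<open>\<D>\<phi>\<close>: S-continuity of \<open>\<D>\<phi>\<close> gives, for every standard \<open>e\<close>, a standard \<open>d\<close> such
  that \<open>\<D>\<phi>\<close> varies by less than \<open>e\<close> within distance \<open>d\<close>, since a nearest exceptional grid point
  would be infinitely close to the centre; and \<open>\<phi>\<close> is recovered by summing \<open>\<D>\<phi>\<close>.
\<close>

section \<open>Formulas and transfer\<close>

lemma transferD:
  assumes "\<And>a b. sat (\<lambda>G. G) UNIV a b p" and "range b \<subseteq> internal"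
  shows "sat star_op internal a b p"
  using assms transfer by blast

text \<open>Without internal functions no assignment \<open>b\<close> would be admissible, and the
  right side of \<open>transfer\<close> would hold vacuously even for the unsatisfiable
  \<open>x \<noteq> x\<close>.\<close>

lemma internal_nonempty: "\<exists>f. f \<in> (internal :: ('a::nonstandard_reals \<Rightarrow> 'a) set)"
proof -
  have "\<not> (\<forall>a b. sat (\<lambda>G. G) UNIV a b (Neg (Equal (Var 0) (Var 0))))"
    by simp
  then show ?thesis
    unfolding transfer[where 'a = 'a] by auto
qed

text \<open>Meant for formulas without free function variables: evaluation by simp makes
  \<open>b\<close> disappear, so a single admissible assignment suffices.\<close>

lemma transfer_num:
  assumes "\<And>a b. sat (\<lambda>G. G) UNIV a b p"
  shows "\<exists>b. \<forall>a. sat star_op internal a b p"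
proof -
  obtain f :: "'a \<Rightarrow> 'a" where "f \<in> internal"
    using internal_nonempty by blast
  then have "range (\<lambda>_::nat. f) \<subseteq> internal"
    by auto
  with assms transferD show ?thesis
    by blast
qed

section \<open>Terms and formulas with evaluation rules in both structures\<close>

definition tm_const :: "real \<Rightarrow> num_term" where
  "tm_const r = Op (\<lambda>_ _. r) [] []"

definition tm_add :: "num_term \<Rightarrow> num_term \<Rightarrow> num_term" where
  "tm_add s t = Op (\<lambda>xs _. xs ! 0 + xs ! 1) [s, t] []"

definition tm_mult :: "num_term \<Rightarrow> num_term \<Rightarrow> num_term" where
  "tm_mult s t = Op (\<lambda>xs _. xs ! 0 * xs ! 1) [s, t] []"

definition tm_fun :: "(real \<Rightarrow> real) \<Rightarrow> num_term \<Rightarrow> num_term" where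
  "tm_fun f t = Op (\<lambda>xs _. f (xs ! 0)) [t] []"

text \<open>The shape matches the class axiom \<open>star_op_less\<close>. Its right side becomes
  \<open>star_real 1\<close>, which is known to be \<open>1\<close> only after
  \<open>star_real_1\<close>; hence the late position of \<open>sat_star_less\<close>.\<close>

definition fm_less :: "num_term \<Rightarrow> num_term \<Rightarrow> form" where
  "fm_less s t =
     Equal (Op (\<lambda>xs _. if xs ! 0 < xs ! 1 then 1 else 0) [s, t] []) (Op (\<lambda>_ _. 1) [] [])"

definition fm_in :: "num_term \<Rightarrow> real set \<Rightarrow> form" where
  "fm_in t A = Equal (tm_fun (indicator A) t) (tm_const 1)"

definition fm_imp :: "form \<Rightarrow> form \<Rightarrow> form" where
  "fm_imp p q = Neg (And p (Neg q))"

definition fm_ex :: "nat \<Rightarrow> form \<Rightarrow> form" where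
  "fm_ex i p = Neg (All_num i (Neg p))"

definition fm_ex_fun :: "nat \<Rightarrow> form \<Rightarrow> form" where
  "fm_ex_fun i p = Neg (All_fun i (Neg p))"

lemma eval_standard [simp]:
  "eval (\<lambda>G. G) a b (tm_const r) = r"
  "eval (\<lambda>G. G) a b (tm_add s t) = eval (\<lambda>G. G) a b s + eval (\<lambda>G. G) a b t"
  "eval (\<lambda>G. G) a b (tm_mult s t) = eval (\<lambda>G. G) a b s * eval (\<lambda>G. G) a b t"
  "eval (\<lambda>G. G) a b (tm_fun f t) = f (eval (\<lambda>G. G) a b t)"
  by (simp_all add: tm_const_def tm_add_def tm_mult_def tm_fun_def)

lemma sat_standard [simp]:
  "sat (\<lambda>G. G) F a b (fm_less s t) \<longleftrightarrow> eval (\<lambda>G. G) a b s < eval (\<lambda>G. G) a b t"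
  "sat (\<lambda>G. G) F a b (fm_in t A) \<longleftrightarrow> eval (\<lambda>G. G) a b t \<in> A"
  by (simp_all add: fm_less_def fm_in_def indicator_def)

lemma sat_connectives [simp]:
  "sat I F a b (fm_imp p q) \<longleftrightarrow> (sat I F a b p \<longrightarrow> sat I F a b q)"
  "sat I F a b (fm_ex i p) \<longleftrightarrow> (\<exists>x. sat I F (a(i := x)) b p)"
  "sat I F a b (fm_ex_fun i p) \<longleftrightarrow> (\<exists>f\<in>F. sat I F a (b(i := f)) p)"
  by (auto simp: fm_imp_def fm_ex_def fm_ex_fun_def)

lemma eval_star_const [simp]: "eval star_op a b (tm_const r) = star_real r"
  by (simp add: tm_const_def star_real_def)

lemma eval_star_add [simp]:
  "eval star_op a b (tm_add s t) = eval star_op a b s + eval star_op a b t"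
  by (simp add: tm_add_def star_op_add[simplified])

lemma eval_star_mult [simp]:
  "eval star_op a b (tm_mult s t) = eval star_op a b s * eval star_op a b t"
  by (simp add: tm_mult_def star_op_mult[simplified])

lemma eval_star_fun [simp]: "eval star_op a b (tm_fun f t) = star_fun f (eval star_op a b t)"
  by (simp add: tm_fun_def star_fun_def)

section \<open>The embedding of the reals preserves arithmetic and order\<close>

lemma star_real_add: "star_real (r + s) = star_real r + star_real s"
  using transfer_num[of "Equal (tm_const (r + s)) (tm_add (tm_const r) (tm_const s))"] by simp

lemma star_real_mult: "star_real (r * s) = star_real r * star_real s"
  using transfer_num[of "Equal (tm_const (r * s)) (tm_mult (tm_const r) (tm_const s))"] by simp

lemma star_real_0 [simp]: "star_real 0 = 0"
  using star_real_add[of 0 0] by simp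

text \<open>\<open>star_real 1\<close> is idempotent under multiplication, and transfer of
  \<open>1 \<noteq> 0\<close> excludes the root \<open>0\<close>.\<close>

lemma star_real_1 [simp]: "star_real 1 = (1::'a::nonstandard_reals)"
proof -
  have "star_real 1 \<noteq> (star_real 0 :: 'a)"
    using transfer_num[of "Neg (Equal (tm_const 1) (tm_const 0))"] by simp
  then show ?thesis
    using star_real_mult[of 1 1, where 'a = 'a] by simp
qed

lemma sat_star_less [simp]:
  "sat star_op F a b (fm_less s t) \<longleftrightarrow> eval star_op a b s < eval star_op a b t"
proof -
  have "star_op (\<lambda>_ _. 1) [] [] = (1::'a)"
    using star_real_1 by (simp add: star_real_def)
  then show ?thesis
    by (simp add: fm_less_def star_op_less[simplified])
qed

lemma sat_star_in [simp]:
  "sat star_op F a b (fm_in t A) \<longleftrightarrow> eval star_op a b t \<in> star_set A"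
  by (simp add: fm_in_def star_set_def)

lemma star_real_less_iff [simp]: "star_real r < star_real s \<longleftrightarrow> r < s"
proof (cases "r < s")
  case True
  then show ?thesis
    using transfer_num[of "fm_less (tm_const r) (tm_const s)"] by simp
next
  case False
  then show ?thesis
    using transfer_num[of "Neg (fm_less (tm_const r) (tm_const s))"] by simp
qed

lemma star_real_pos_iff [simp]: "0 < star_real r \<longleftrightarrow> 0 < r"
  using star_real_less_iff[of 0 r] by (simp del: star_real_less_iff)

lemma star_real_le_iff [simp]: "star_real r \<le> star_real s \<longleftrightarrow> r \<le> s"
  by (simp flip: not_less)

lemma star_real_nonneg_iff [simp]: "0 \<le> star_real r \<longleftrightarrow> 0 \<le> r"
  using star_real_le_iff[of 0 r] by (simp del: star_real_le_iff)

lemma star_real_eq_iff [simp]: "star_real r = star_real s \<longleftrightarrow> r = s"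
  by (simp add: order.eq_iff)

lemma star_real_minus: "star_real (- r) = - star_real r"
  using star_real_add[of r "- r"] by (simp add: eq_neg_iff_add_eq_0 add.commute)

lemma star_real_diff: "star_real (r - s) = star_real r - star_real s"
  using star_real_add[of r "- s"] by (simp add: star_real_minus)

lemma star_real_inverse: "star_real (inverse r) = inverse (star_real r)"
  by (metis inverse_unique inverse_zero right_inverse star_real_0 star_real_1 star_real_mult)

lemma star_real_divide: "star_real (r / s) = star_real r / star_real s"
  by (simp add: divide_inverse star_real_mult star_real_inverse)

lemma star_real_abs: "star_real \<bar>r\<bar> = \<bar>star_real r\<bar>"
  by (metis abs_of_neg abs_of_nonneg not_less star_real_0 star_real_less_iff star_real_minus)

lemma star_real_numeral [simp]: "star_real (numeral n) = numeral n"
  by (induction n) (simp_all only: numeral.simps star_real_add star_real_1)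

definition fm_le :: "num_term \<Rightarrow> num_term \<Rightarrow> form" where
  "fm_le s t = Neg (fm_less t s)"

text \<open>The class axioms interpret addition, multiplication and order, so subtraction is reduced
  to these.\<close>

definition tm_diff :: "num_term \<Rightarrow> num_term \<Rightarrow> num_term" where
  "tm_diff s t = tm_add s (tm_mult (tm_const (-1)) t)"

definition tm_sum :: "nat \<Rightarrow> nat \<Rightarrow> num_term" where
  "tm_sum i j = Op (\<lambda>_ fs. \<Sum>x | (fs ! 1) x = 1. (fs ! 0) x) [] [i, j]"

lemma eval_sat_standard_derived [simp]:
  "eval (\<lambda>G. G) a b (tm_diff s t) = eval (\<lambda>G. G) a b s - eval (\<lambda>G. G) a b t"
  "eval (\<lambda>G. G) a b (tm_sum i j) = (\<Sum>x | b j x = 1. b i x)"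
  "sat (\<lambda>G. G) F a b (fm_le s t) \<longleftrightarrow> eval (\<lambda>G. G) a b s \<le> eval (\<lambda>G. G) a b t"
  by (auto simp: tm_diff_def tm_sum_def fm_le_def)

lemma eval_sat_star_derived [simp]:
  "eval star_op a b (tm_diff s t) = eval star_op a b s - eval star_op a b t"
  "b j = indicator A \<Longrightarrow> eval star_op a b (tm_sum i j) = hyperfinite_sum (b i) A"
  "sat star_op F a b (fm_le s t) \<longleftrightarrow> eval star_op a b s \<le> eval star_op a b t"
  by (auto simp: tm_diff_def tm_sum_def fm_le_def hyperfinite_sum_def star_real_minus)

text \<open>The extended inverse is identified with the field inverse through its defining
  equations, including the default \<open>inverse 0 = 0\<close>.\<close>

lemma star_fun_inverse [simp]: "star_fun inverse x = inverse (x :: 'a::nonstandard_reals)"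
proof -
  let ?inv = "tm_fun inverse (Var 0)"
  have "\<exists>b. \<forall>a. sat star_op (internal :: ('a \<Rightarrow> 'a) set) a b
      (And (fm_imp (Neg (Equal (Var 0) (tm_const 0))) (Equal (tm_mult (Var 0) ?inv) (tm_const 1)))
        (fm_imp (Equal (Var 0) (tm_const 0)) (Equal ?inv (tm_const 0))))"
    by (rule transfer_num) simp
  \<comment> \<open>The assignment is taken constant, so that \<open>Var 0\<close> denotes an
    arbitrary hyperreal.\<close>
  then have "\<forall>x. (x \<noteq> 0 \<longrightarrow> x * star_fun inverse x = 1) \<and> (x = 0 \<longrightarrow> star_fun inverse x = (0::'a))"
    by (auto dest: spec[of _ "\<lambda>_. _"])
  then show ?thesis
    by (metis inverse_unique inverse_zero)
qed

lemma star_fun_abs [simp]: "star_fun abs x = \<bar>x :: 'a::nonstandard_reals\<bar>"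
proof -
  let ?abs = "tm_fun abs (Var 0)"
  have "\<exists>b. \<forall>a. sat star_op (internal :: ('a \<Rightarrow> 'a) set) a b
      (And (fm_imp (fm_less (Var 0) (tm_const 0)) (Equal (tm_add ?abs (Var 0)) (tm_const 0)))
        (fm_imp (fm_le (tm_const 0) (Var 0)) (Equal ?abs (Var 0))))"
    by (rule transfer_num) simp
  then have "\<forall>x. (x < 0 \<longrightarrow> star_fun abs x + x = 0) \<and> (0 \<le> x \<longrightarrow> star_fun abs x = (x::'a))"
    by (auto dest: spec[of _ "\<lambda>_. _"])
  then show ?thesis
    by (metis abs_of_neg abs_of_nonneg eq_neg_iff_add_eq_0 not_less)
qed

definition tm_divide :: "num_term \<Rightarrow> num_term \<Rightarrow> num_term" where
  "tm_divide s t = tm_mult s (tm_fun inverse t)"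

definition fm_or :: "form \<Rightarrow> form \<Rightarrow> form" where
  "fm_or p q = fm_imp (Neg p) q"

lemma eval_divide [simp]:
  "eval (\<lambda>G. G) a b (tm_divide s t) = eval (\<lambda>G. G) a b s / eval (\<lambda>G. G) a b t"
  "eval star_op a' b' (tm_divide s t) = eval star_op a' b' s / eval star_op a' b' t"
  by (simp_all add: tm_divide_def divide_inverse)

lemma sat_or [simp]: "sat I F a b (fm_or p q) \<longleftrightarrow> sat I F a b p \<or> sat I F a b q"
  by (auto simp: fm_or_def)

section \<open>Finite and infinitely close hyperreals\<close>

lemma hfinite_star_real [simp]: "hfinite (star_real r)"
  unfolding hfinite_def by (metis order_refl star_real_abs)

lemma hfinite_0 [simp]: "hfinite 0"
  using hfinite_star_real[of 0] by simp

lemma hfinite_add: "hfinite x \<Longrightarrow> hfinite y \<Longrightarrow> hfinite (x + y)"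
  unfolding hfinite_def by (metis abs_triangle_ineq add_mono order_trans star_real_add)

lemma inf_close_refl [simp]: "inf_close x x"
  by (simp add: inf_close_def)

lemma inf_close_sym: "inf_close x y \<Longrightarrow> inf_close y x"
  by (simp add: inf_close_def abs_minus_commute)

lemma inf_close_trans:
  assumes "inf_close x y" "inf_close y z"
  shows "inf_close x z"
  unfolding inf_close_def
proof (intro allI impI)
  fix r :: real
  assume "0 < r"
  then have "\<bar>x - y\<bar> < star_real (r/2)" "\<bar>y - z\<bar> < star_real (r/2)"
    using assms unfolding inf_close_def by (metis half_gt_zero)+
  moreover have "star_real r = star_real (r/2) + (star_real (r/2) :: 'a)"
    by (simp flip: star_real_add)
  ultimately show "\<bar>x - z\<bar> < star_real r"
    by linarith
qed

lemma inf_close_hfinite: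
  assumes "inf_close x y" "hfinite y"
  shows "hfinite x"
proof -
  have "\<bar>x - y\<bar> < star_real 1"
    using assms(1) unfolding inf_close_def by (metis zero_less_one)
  then have "hfinite (x - y)"
    unfolding hfinite_def by (metis less_imp_le)
  from hfinite_add[OF this assms(2)] show ?thesis
    by simp
qed

lemma inf_close_star_real_iff [simp]: "inf_close (star_real r) (star_real s) \<longleftrightarrow> r = s"
proof
  assume "inf_close (star_real r :: 'a) (star_real s)"
  then have "\<forall>e>0. star_real \<bar>r - s\<bar> < (star_real e :: 'a)"
    by (simp add: inf_close_def star_real_abs star_real_diff)
  then show "r = s"
    by (metis abs_not_less_zero eq_iff_diff_eq_0 less_irrefl star_real_less_iff zero_less_abs_iff)
qed simp

text \<open>The standard part is the supremum of the standard reals below \<open>x\<close>; this is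
  where completeness of the reals enters.\<close>

lemma hfinite_inf_close:
  fixes x :: "'a::nonstandard_reals"
  assumes "hfinite x"
  shows "\<exists>r. inf_close x (star_real r)"
proof -
  obtain B where B: "\<bar>x\<bar> \<le> star_real B"
    using assms by (auto simp: hfinite_def)
  define S where "S = {r. star_real r \<le> x}"
  have bound: "s \<le> B" if "s \<in> S" for s
  proof -
    have "star_real s \<le> x"
      using that by (simp add: S_def)
    also have "x \<le> star_real B"
      using B by (simp add: abs_le_iff)
    finally have "star_real s \<le> (star_real B :: 'a)" .
    then show ?thesis by simp
  qed
  then have bdd: "bdd_above S"
    by (auto simp: bdd_above_def)
  have "- B \<in> S"
    using B by (auto simp: S_def star_real_minus)
  then have ne: "S \<noteq> {}"
    by blast
  have "\<bar>x - star_real (Sup S)\<bar> < star_real e" if pos: "0 < e" for e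
  proof -
    obtain s where "s \<in> S" "Sup S - e < s"
      using less_cSup_iff[OF ne bdd, of "Sup S - e"] pos by auto
    then have "star_real (Sup S - e) < (star_real s :: 'a)" "star_real s \<le> x"
      by (simp_all add: S_def)
    then have lb: "star_real (Sup S - e) < x"
      by (rule less_le_trans)
    have "Sup S + e/2 \<notin> S"
      using cSup_upper[OF _ bdd, of "Sup S + e/2"] that by auto
    then have "x < star_real (Sup S + e/2)"
      by (simp add: S_def not_le)
    also have "star_real (Sup S + e/2) < (star_real (Sup S + e) :: 'a)"
      using pos by simp
    finally have "x < star_real (Sup S + e)" .
    with lb show ?thesis
      unfolding star_real_add star_real_diff by (simp add: abs_less_iff algebra_simps)
  qed
  then show ?thesis
    unfolding inf_close_def by blast
qed

lemma st_part_eqI: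
  assumes "inf_close x (star_real r)"
  shows "st_part x = r"
  unfolding st_part_def
proof (rule the_equality)
  fix s
  assume "inf_close x (star_real s)"
  from inf_close_trans[OF inf_close_sym[OF this] assms] show "s = r"
    by simp
qed (fact assms)

lemma inf_close_st_part:
  assumes "hfinite x"
  shows "inf_close x (star_real (st_part x))"
  using hfinite_inf_close[OF assms] st_part_eqI by metis

lemma inf_close_diff:
  assumes "inf_close x y" "inf_close x' y'"
  shows "inf_close (x - x') (y - y')"
proof -
  have "inf_close (x - x') (y - x')"
    using assms(1) by (simp add: inf_close_def)
  moreover have "inf_close (y - x') (y - y')"
    using assms(2) by (simp add: inf_close_def abs_minus_commute)
  ultimately show ?thesis
    by (rule inf_close_trans)
qed

lemma inf_close_mult_left:
  fixes x y c :: "'a::nonstandard_reals"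
  assumes "inf_close x y" "hfinite c"
  shows "inf_close (c * x) (c * y)"
  unfolding inf_close_def
proof (intro allI impI)
  fix e :: real
  assume "0 < e"
  obtain B where B: "\<bar>c\<bar> \<le> star_real B"
    using assms(2) by (auto simp: hfinite_def)
  have "0 \<le> (star_real B :: 'a)"
    by (rule order_trans[OF abs_ge_zero B])
  then have B0: "0 \<le> B"
    by simp
  \<comment> \<open>\<open>B\<close> may be 0, hence the divisor \<open>B + 1\<close>.\<close>
  have "\<bar>x - y\<bar> < star_real (e / (B + 1))"
    using assms(1) \<open>0 < e\<close> B0 by (simp add: inf_close_def)
  moreover have "\<bar>c\<bar> < star_real (B + 1)"
    using B by (simp add: star_real_add add_strict_increasing2 le_less_trans)
  ultimately have "\<bar>c\<bar> * \<bar>x - y\<bar> < star_real (B + 1) * star_real (e / (B + 1))"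
    by (intro mult_strict_mono') auto
  also have "\<dots> = star_real e"
    using B0 by (simp flip: star_real_mult)
  finally show "\<bar>c * x - c * y\<bar> < star_real e"
    by (simp flip: right_diff_distrib add: abs_mult)
qed

section \<open>Hyperintegers\<close>

lemma star_set_mono:
  assumes "A \<subseteq> B"
  shows "star_set A \<subseteq> (star_set B :: 'a::nonstandard_reals set)"
proof -
  have "\<exists>b. \<forall>a. sat star_op (internal :: ('a \<Rightarrow> 'a) set) a b (fm_imp (fm_in (Var 0) A) (fm_in (Var 0) B))"
    using assms by (intro transfer_num) auto
  then show ?thesis
    by (auto dest: spec[of _ "\<lambda>_. _"])
qed

lemma star_set_atLeast: "star_set {r..} = {star_real r ..}"
proof -
  have "\<exists>b. \<forall>a. sat star_op (internal :: ('a::nonstandard_reals \<Rightarrow> 'a) set) a b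
     (And (fm_imp (fm_in (Var 0) {r..}) (fm_le (tm_const r) (Var 0)))
      (fm_imp (fm_le (tm_const r) (Var 0)) (fm_in (Var 0) {r..})))"
    by (intro transfer_num) auto
  then show "star_set {r..} = {star_real r :: 'a::nonstandard_reals ..}"
    by (auto dest: spec[of _ "\<lambda>_. _"])
qed

lemma star_Nats_nonneg: "n \<in> star_set \<nat> \<Longrightarrow> 0 \<le> n"
  using star_set_mono[of \<nat> "{0..}"] by (auto simp: star_set_atLeast Nats_altdef2)

lemma star_Nats_subset_Ints: "star_set \<nat> \<subseteq> star_set \<int>"
  by (rule star_set_mono) (auto simp: Nats_altdef2)

lemma star_real_mem_star_set: "r \<in> A \<Longrightarrow> star_real r \<in> star_set A"
  using transfer_num[of "fm_in (tm_const r) A"] by simp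

text \<open>The second conclusion is discreteness. It settles finite hypernaturals below and later
  the step from the last point of the ramp to its top.\<close>

lemma star_Ints_closed:
  fixes m n :: "'a::nonstandard_reals"
  assumes "m \<in> star_set \<int>" "n \<in> star_set \<int>"
  shows "m + n \<in> star_set \<int>" "m < n \<Longrightarrow> m + 1 \<le> n"
proof -
  have "\<exists>b. \<forall>a. sat star_op (internal :: ('a \<Rightarrow> 'a) set) a b
     (fm_imp (And (fm_in (Var 0) \<int>) (fm_in (Var 1) \<int>))
       (And (fm_in (tm_add (Var 0) (Var 1)) \<int>)
         (fm_imp (fm_less (Var 0) (Var 1)) (fm_le (tm_add (Var 0) (tm_const 1)) (Var 1)))))"
    by (intro transfer_num) (auto elim!: Ints_cases)
  then have "m + n \<in> star_set \<int> \<and> (m < n \<longrightarrow> m + 1 \<le> n)"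
    using assms by (auto dest: spec[of _ "\<lambda>i. if i = 0 then m else n"])
  then show "m + n \<in> star_set \<int>" "m < n \<Longrightarrow> m + 1 \<le> n"
    by auto
qed

lemma star_Ints_floor: "\<exists>n\<in>star_set \<int>. n \<le> x \<and> x < n + (1 :: 'a::nonstandard_reals)"
proof -
  have "\<exists>b. \<forall>a. sat star_op (internal :: ('a \<Rightarrow> 'a) set) a b
     (fm_ex 1 (And (fm_in (Var 1) \<int>)
       (And (fm_le (Var 1) (Var 0)) (fm_less (Var 0) (tm_add (Var 1) (tm_const 1))))))"
  proof (intro transfer_num)
    fix a :: "nat \<Rightarrow> real" and b
    show "sat (\<lambda>G. G) UNIV a b (fm_ex 1 (And (fm_in (Var 1) \<int>)
       (And (fm_le (Var 1) (Var 0)) (fm_less (Var 0) (tm_add (Var 1) (tm_const 1))))))"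
      by (simp add: exI[of _ "of_int \<lfloor>a 0\<rfloor>"])
  qed
  then show ?thesis
    by (auto dest: spec[of _ "\<lambda>_. x"])
qed

text \<open>Carries infinitude over from \<open>N0\<close> to its factorial
  \<open>N\<close>.\<close>

lemma star_fact_ge:
  assumes "n \<in> star_set \<nat>"
  shows "n \<le> star_fact (n :: 'a::nonstandard_reals)"
proof -
  have "\<exists>b. \<forall>a. sat star_op (internal :: ('a \<Rightarrow> 'a) set) a b
     (fm_imp (fm_in (Var 0) \<nat>) (fm_le (Var 0) (tm_fun (\<lambda>x. fact (nat \<lfloor>x\<rfloor>)) (Var 0))))"
  proof (intro transfer_num)
    have "real n \<le> fact n" for n
      using fact_ge_self[of n] by (metis of_nat_fact of_nat_le_iff)
    then show "sat (\<lambda>G. G) UNIV a b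
      (fm_imp (fm_in (Var 0) \<nat>) (fm_le (Var 0) (tm_fun (\<lambda>x. fact (nat \<lfloor>x\<rfloor>)) (Var 0))))" for a b
      by (auto elim!: Nats_cases)
  qed
  then show ?thesis
    using assms by (auto simp: star_fact_def dest: spec[of _ "\<lambda>_. n"])
qed

text \<open>By discreteness a hypernatural below \<open>k + 1\<close> is either \<open>k\<close> or
  below \<open>k\<close>, so induction on a standard bound finds it among the standard ones.
  Contrapositively, a nonstandard \<open>M\<close> is infinite.\<close>

lemma star_Nats_hfinite:
  fixes n :: "'a::nonstandard_reals"
  assumes "n \<in> star_set \<nat>" "hfinite n"
  shows "n \<in> star_real ` \<nat>"
proof -
  have *: "n \<in> star_real ` \<nat>" if "n < star_real (real k)" for k
    using that
  proof (induction k)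
    case 0
    then show ?case
      using star_Nats_nonneg[OF assms(1)] by simp
  next
    case (Suc k)
    have "star_real (real k) \<in> star_set \<int>"
      by (simp add: star_real_mem_star_set)
    moreover have "n \<in> star_set \<int>"
      using assms(1) star_Nats_subset_Ints by blast
    ultimately have "\<not> star_real (real k) < n"
      using star_Ints_closed(2)[of "star_real (real k)" n] Suc.prems by (auto simp: star_real_add add.commute)
    then consider "n = star_real (real k)" | "n < star_real (real k)"
      by fastforce
    then show ?case
      using Suc.IH by cases auto
  qed
  obtain r where "\<bar>n\<bar> \<le> star_real r"
    using assms(2) by (auto simp: hfinite_def)
  then have "n \<le> star_real r"
    by (simp add: abs_le_iff)
  also obtain k where "r < real k"
    using reals_Archimedean2 by blast
  then have "star_real r < (star_real (real k) :: 'a)"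
    by simp
  finally show ?thesis
    by (rule *)
qed

section \<open>The grid\<close>

text \<open>The grid with a real parameter, phrased through \<open>x * N\<close> without division or
  unary minus, so that \<open>fm_grid\<close> expresses it directly in both structures.\<close>

definition standard_grid :: "real \<Rightarrow> real set" where
  "standard_grid N = {x. x * N \<in> \<int> \<and> 0 \<le> N * N + x * N \<and> x * N \<le> N * N}"

definition fm_grid :: "num_term \<Rightarrow> num_term \<Rightarrow> form" where
  "fm_grid s t = And (fm_in (tm_mult s t) \<int>)
     (And (fm_le (tm_const 0) (tm_add (tm_mult t t) (tm_mult s t)))
       (fm_le (tm_mult s t) (tm_mult t t)))"

lemma sat_standard_grid [simp]:
  "sat (\<lambda>G. G) F a b (fm_grid s t) \<longleftrightarrow> eval (\<lambda>G. G) a b s \<in> standard_grid (eval (\<lambda>G. G) a b t)"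
  by (simp add: fm_grid_def standard_grid_def)

lemma grid_iff:
  fixes N x :: "'a::nonstandard_reals"
  assumes "0 < N"
  shows "x \<in> grid N \<longleftrightarrow> x * N \<in> star_set \<int> \<and> - (N * N) \<le> x * N \<and> x * N \<le> N * N"
proof -
  have "x = n * eps N \<longleftrightarrow> n = x * N" for n
    using assms by (auto simp: eps_def field_simps)
  then show ?thesis
    unfolding grid_def by (auto simp: power2_eq_square)
qed

text \<open>Positivity matters because \<open>grid\<close> is defined through
  \<open>eps N = 1 / N\<close>, whereas \<open>fm_grid\<close> multiplies by
  \<open>N\<close>.\<close>

lemma sat_star_grid [simp]:
  assumes "0 < eval star_op a b t"
  shows "sat star_op F a b (fm_grid s t) \<longleftrightarrow> eval star_op a b s \<in> grid (eval star_op a b t)"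
proof -
  have "0 \<le> u + v \<longleftrightarrow> - u \<le> v" for u v :: 'a
    by linarith
  then show ?thesis
    using assms by (simp add: fm_grid_def grid_iff)
qed

text \<open>Finiteness makes sums over the standard grid genuine and lets minima be attained; both
  consequences are then transferred.\<close>

lemma finite_standard_grid:
  assumes "0 < N"
  shows "finite (standard_grid N)"
proof -
  have "standard_grid N \<subseteq> (\<lambda>k. of_int k / N) ` {- \<lceil>N * N\<rceil>..\<lfloor>N * N\<rfloor>}"
  proof
    fix x
    assume x: "x \<in> standard_grid N"
    then obtain k where k: "x * N = of_int k"
      by (auto simp: standard_grid_def elim: Ints_cases)
    have "- of_int k \<le> N * N" "of_int k \<le> N * N"
      using x k by (auto simp: standard_grid_def)
    then have "- k \<le> \<lceil>N * N\<rceil>" "k \<le> \<lfloor>N * N\<rfloor>"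
      by linarith+
    moreover have "x = of_int k / N"
      using k assms by (simp add: field_simps)
    ultimately show "x \<in> (\<lambda>k. of_int k / N) ` {- \<lceil>N * N\<rceil>..\<lfloor>N * N\<rfloor>}"
      by auto
  qed
  then show ?thesis
    by (rule finite_subset) simp
qed

section \<open>Internal functions\<close>

text \<open>Pattern for closure of \<open>internal\<close>: transfer the assertion that a function
  with the desired values exists, then identify the internal witness pointwise.\<close>

lemma internal_mult:
  fixes f g :: "'a::nonstandard_reals \<Rightarrow> 'a"
  assumes "f \<in> internal" "g \<in> internal"
  shows "(\<lambda>x. f x * g x) \<in> internal"
proof -
  let ?p = "fm_ex_fun 2 (All_num 0 (Equal (App 2 (Var 0)) (tm_mult (App 0 (Var 0)) (App 1 (Var 0)))))"
  have "sat star_op (internal :: ('a \<Rightarrow> 'a) set) (\<lambda>_. 0) (\<lambda>i. if i = 0 then f else g) ?p"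
  proof (rule transferD)
    show "sat (\<lambda>G. G) UNIV a b ?p" for a b
      by (simp add: exI[of _ "\<lambda>x. b 0 x * b 1 x"])
  qed (use assms in auto)
  then obtain k where "k \<in> internal" "\<forall>x. k x = f x * g x"
    by auto
  moreover from this have "k = (\<lambda>x. f x * g x)"
    by auto
  ultimately show ?thesis
    by simp
qed

text \<open>Makes the grid available as the set argument when sums are transferred. Multiplication
  by the indicator also cuts internal functions down to the grid.\<close>

lemma internal_indicator_grid:
  fixes N :: "'a::nonstandard_reals"
  assumes "0 < N"
  shows "indicator (grid N) \<in> internal"
proof -
  let ?p = "fm_ex_fun 0 (All_num 1
      (And (fm_imp (fm_grid (Var 1) (Var 0)) (Equal (App 0 (Var 1)) (tm_const 1)))
        (fm_imp (Neg (fm_grid (Var 1) (Var 0))) (Equal (App 0 (Var 1)) (tm_const 0)))))"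
  have "\<exists>b. \<forall>a. sat star_op (internal :: ('a \<Rightarrow> 'a) set) a b ?p"
  proof (rule transfer_num)
    show "sat (\<lambda>G. G) UNIV a b ?p" for a b
      by (simp add: exI[of _ "indicator (standard_grid (a 0))"])
  qed
  then obtain b where "sat star_op (internal :: ('a \<Rightarrow> 'a) set) (\<lambda>_. N) b ?p"
    by blast
  then obtain k where "k \<in> internal"
      "\<forall>x. (x \<in> grid N \<longrightarrow> k x = 1) \<and> (x \<notin> grid N \<longrightarrow> k x = 0)"
    using assms by auto
  moreover from this have "k = indicator (grid N)"
    by (auto simp: fun_eq_iff indicator_def)
  ultimately show ?thesis
    by simp
qed

lemma internal_grid_diff:
  fixes f :: "'a::nonstandard_reals \<Rightarrow> 'a"
  assumes "0 < N" "f \<in> internal"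
  shows "grid_diff N f \<in> internal"
proof -
  let ?p = "fm_ex_fun 1 (All_num 2 (Equal (App 1 (Var 2))
      (tm_mult (Var 0) (tm_diff (App 0 (tm_add (Var 2) (Var 1))) (App 0 (Var 2))))))"
  \<comment> \<open>\<open>eps N\<close> and its inverse enter as two independent parameters, so no
    division occurs in the formula.\<close>
  have "sat star_op (internal :: ('a \<Rightarrow> 'a) set)
      (\<lambda>i. if i = 0 then inverse (eps N) else eps N) (\<lambda>_. f) ?p"
  proof (rule transferD)
    show "sat (\<lambda>G. G) UNIV a b ?p" for a b
      by (simp add: exI[of _ "\<lambda>x. a 0 * (b 0 (x + a 1) - b 0 x)"])
  qed (use assms in auto)
  then obtain k where k: "k \<in> internal" "\<forall>x. k x = inverse (eps N) * (f (x + eps N) - f x)"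
    by auto
  then have "grid_diff N f = (\<lambda>x. indicator (grid N) x * k x)"
    by (auto simp: fun_eq_iff grid_diff_def)
  then show ?thesis
    using internal_mult[OF internal_indicator_grid[OF assms(1)] k(1)] by simp
qed

section \<open>Transfer of facts on grid functions\<close>

text \<open>A nonempty finite set of reals has an element nearest to a given point. Transfer of this
  to the exceptional grid points takes the place of an overspill argument.\<close>

lemma nearest_exception:
  fixes f :: "'a::nonstandard_reals \<Rightarrow> 'a"
  assumes "f \<in> internal" "0 < N" "x \<in> grid N" "e \<le> \<bar>f x - c\<bar>"
  obtains y where "y \<in> grid N" "e \<le> \<bar>f y - c\<bar>"
    "\<And>z. z \<in> grid N \<Longrightarrow> e \<le> \<bar>f z - c\<bar> \<Longrightarrow> \<bar>y - a\<bar> \<le> \<bar>z - a\<bar>"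
proof -
  let ?bad = "\<lambda>i. And (fm_grid (Var i) (Var 0))
     (fm_le (Var 1) (tm_fun abs (tm_diff (App 0 (Var i)) (Var 2))))"
  let ?p = "fm_imp (And (fm_less (tm_const 0) (Var 0)) (?bad 4))
     (fm_ex 5 (And (?bad 5) (All_num 6 (fm_imp (?bad 6)
        (fm_le (tm_fun abs (tm_diff (Var 5) (Var 3))) (tm_fun abs (tm_diff (Var 6) (Var 3))))))))"
  \<comment> \<open>\<open>Var 0\<close> to \<open>Var 4\<close> stand for \<open>N\<close>,
    \<open>e\<close>, \<open>c\<close>, \<open>a\<close>, \<open>x\<close>; the indices 5 and 6 are
    bound.\<close>
  have "sat star_op (internal :: ('a \<Rightarrow> 'a) set) (\<lambda>i. [N, e, c, a, x] ! i) (\<lambda>_. f) ?p"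
  proof (rule transferD)
    fix a :: "nat \<Rightarrow> real" and b :: "nat \<Rightarrow> real \<Rightarrow> real"
    define B where "B = {y \<in> standard_grid (a 0). a 1 \<le> \<bar>b 0 y - a 2\<bar>}"
    have "\<exists>y\<in>B. \<forall>z\<in>B. \<bar>y - a 3\<bar> \<le> \<bar>z - a 3\<bar>" if "0 < a 0" "a 4 \<in> B"
    proof -
      have fin: "finite B"
        using finite_standard_grid[OF that(1)] by (simp add: B_def)
      have ne: "B \<noteq> {}"
        using that(2) by blast
      show ?thesis
        using arg_min_if_finite[OF fin ne, of "\<lambda>y. \<bar>y - a 3\<bar>"]
        by (meson not_less)
    qed
    then show "sat (\<lambda>G. G) UNIV a b ?p"
      by (simp add: B_def)
  qed (use assms in auto)
  then have "\<exists>y. y \<in> grid N \<and> e \<le> \<bar>f y - c\<bar> \<and>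
      (\<forall>z. z \<in> grid N \<and> e \<le> \<bar>f z - c\<bar> \<longrightarrow> \<bar>y - a\<bar> \<le> \<bar>z - a\<bar>)"
    using assms by simp
  with that show ?thesis
    by blast
qed

lemma S_continuous_eps_delta:
  fixes f :: "'a::nonstandard_reals \<Rightarrow> 'a"
  assumes f: "f \<in> internal" and N: "0 < N" and e: "0 < e"
    and cont: "\<And>y. y \<in> grid N \<Longrightarrow> inf_close y x \<Longrightarrow> inf_close (f y) c"
  obtains d where "0 < d" "\<And>y. y \<in> grid N \<Longrightarrow> \<bar>y - x\<bar> < star_real d \<Longrightarrow> \<bar>f y - c\<bar> < star_real e"
proof (rule ccontr)
  assume "\<not> thesis"
  with that have bad: "\<exists>y\<in>grid N. \<bar>y - x\<bar> < star_real d \<and> star_real e \<le> \<bar>f y - c\<bar>" if "0 < d" for d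
    using \<open>0 < d\<close> by (metis not_less)
  obtain z where z: "z \<in> grid N" "star_real e \<le> \<bar>f z - c\<bar>"
    using bad[of 1] by auto
  obtain y where y: "y \<in> grid N" "star_real e \<le> \<bar>f y - c\<bar>"
    and nearest: "\<And>z. z \<in> grid N \<Longrightarrow> star_real e \<le> \<bar>f z - c\<bar> \<Longrightarrow> \<bar>y - x\<bar> \<le> \<bar>z - x\<bar>"
    using nearest_exception[OF f N z] by blast
  have "inf_close y x"
    unfolding inf_close_def using bad nearest by (meson le_less_trans)
  then have "\<bar>f y - c\<bar> < star_real e"
    using cont[OF y(1)] e by (simp add: inf_close_def)
  with y(2) show False
    by simp
qed

text \<open>A discrete mean value estimate: going from \<open>x\<close> to \<open>y\<close> in steps
  of \<open>1/N\<close>, each step adds an error of at most \<open>e/N\<close>.\<close>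

lemma standard_grid_increment:
  fixes f :: "real \<Rightarrow> real"
  assumes N: "0 < N" and xy: "x \<in> standard_grid N" "y \<in> standard_grid N" "x \<le> y"
    and slope: "\<And>z. z \<in> standard_grid N \<Longrightarrow> x \<le> z \<Longrightarrow> z < y \<Longrightarrow> \<bar>N * (f (z + inverse N) - f z) - D\<bar> \<le> e"
  shows "\<bar>f y - f x - D * (y - x)\<bar> \<le> e * (y - x)"
proof -
  obtain i j where ij: "x * N = of_int i" "y * N = of_int j"
    using xy unfolding standard_grid_def by (auto elim!: Ints_cases)
  have "x * N \<le> y * N"
    using N xy(3) by (simp add: mult_right_mono)
  then have "i \<le> j"
    using ij by simp
  then obtain n :: nat where j: "j = i + int n"
    using zle_iff_zadd by blast
  have y: "y = x + n / N"
    using ij j N by (simp add: field_simps)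
  have "\<bar>f (x + k / N) - f x - D * (k / N)\<bar> \<le> e * (k / N)" if "k \<le> n" for k
    using that
  proof (induction k)
    case 0
    then show ?case by simp
  next
    case (Suc k)
    let ?z = "x + k / N"
    have zN: "?z * N = of_int (i + int k)"
      using ij N by (simp add: field_simps)
    \<comment> \<open>Intermediate points inherit the range bounds of the grid from \<open>x\<close>
      and \<open>y\<close>.\<close>
    moreover have "x * N \<le> ?z * N" "?z * N \<le> y * N"
      using zN ij j Suc.prems by auto
    ultimately have z: "?z \<in> standard_grid N"
      using xy unfolding standard_grid_def by auto
    have "x \<le> ?z" "?z < y"
      using Suc.prems N by (simp_all add: y divide_strict_right_mono)
    note slope[OF z this]
    moreover have "?z + inverse N = x + Suc k / N"
      using N by (simp add: field_simps)
    ultimately have "\<bar>N * (f (x + Suc k / N) - f ?z) - D\<bar> \<le> e"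
      by simp
    then have "\<bar>N * (f (x + Suc k / N) - f ?z) - D\<bar> / N \<le> e / N"
      using N by (simp add: divide_right_mono)
    also have "\<bar>N * (f (x + Suc k / N) - f ?z) - D\<bar> / N = \<bar>(N * (f (x + Suc k / N) - f ?z) - D) / N\<bar>"
      using N by simp
    also have "(N * (f (x + Suc k / N) - f ?z) - D) / N = f (x + Suc k / N) - f ?z - D / N"
      using N by (simp add: field_simps)
    finally have "\<bar>f (x + Suc k / N) - f ?z - D / N\<bar> \<le> e / N" .
    moreover have "\<bar>f ?z - f x - D * (k / N)\<bar> \<le> e * (k / N)"
      using Suc by simp
    moreover have "D * (Suc k / N) = D * (k / N) + D / N" "e * (Suc k / N) = e * (k / N) + e / N"
      by (simp_all add: algebra_simps add_divide_distrib)
    ultimately show ?case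
      by linarith
  qed
  from this[of n] show ?thesis
    by (simp add: y)
qed

lemma grid_increment:
  fixes f :: "'a::nonstandard_reals \<Rightarrow> 'a"
  assumes f: "f \<in> internal" and N: "0 < N" and xy: "x \<in> grid N" "y \<in> grid N" "x \<le> y"
    and slope: "\<And>z. z \<in> grid N \<Longrightarrow> x \<le> z \<Longrightarrow> z < y \<Longrightarrow> \<bar>grid_diff N f z - D\<bar> \<le> e"
  shows "\<bar>f y - f x - D * (y - x)\<bar> \<le> e * (y - x)"
proof -
  let ?incr = "\<lambda>s t. tm_diff (App 0 t) (App 0 s)"
  let ?p = "fm_imp (And (fm_less (tm_const 0) (Var 0)) (And (fm_grid (Var 1) (Var 0))
      (And (fm_grid (Var 2) (Var 0)) (And (fm_le (Var 1) (Var 2)) (All_num 5 (fm_imp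
        (And (fm_grid (Var 5) (Var 0)) (And (fm_le (Var 1) (Var 5)) (fm_less (Var 5) (Var 2))))
        (fm_le (tm_fun abs (tm_diff (tm_mult (Var 0)
           (?incr (Var 5) (tm_add (Var 5) (tm_fun inverse (Var 0))))) (Var 3))) (Var 4))))))))
    (fm_le (tm_fun abs (tm_diff (?incr (Var 1) (Var 2)) (tm_mult (Var 3) (tm_diff (Var 2) (Var 1)))))
      (tm_mult (Var 4) (tm_diff (Var 2) (Var 1))))"
  have "sat star_op (internal :: ('a \<Rightarrow> 'a) set) (\<lambda>i. [N, x, y, D, e] ! i) (\<lambda>_. f) ?p"
  proof (rule transferD)
    show "sat (\<lambda>G. G) UNIV a b ?p" for a b
      using standard_grid_increment[of "a 0" "a 1" "a 2" "b 0" "a 3" "a 4"] by simp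
  qed (use f in auto)
  \<comment> \<open>At grid points \<open>grid_diff N f\<close> is the quotient spelled out in the
    formula.\<close>
  moreover have "\<bar>N * (f (z + inverse N) - f z) - D\<bar> \<le> e" if "z \<in> grid N" "x \<le> z" "z < y" for z
    using slope[OF that] that(1) by (simp add: grid_diff_def eps_def inverse_eq_divide)
  ultimately show ?thesis
    using N xy by simp
qed

text \<open>With \<open>n = x * N\<close>, the weights divided by \<open>N\<close> are
  \<open>n / (M * M)\<close>; summed over \<open>n < M\<close> they give
  \<open>(M - 1) / (2 * M)\<close>. The pointwise errors add up with the same weights.\<close>

lemma standard_grid_sum:
  fixes F :: "real \<Rightarrow> real"
  assumes N: "0 < N" and M: "M \<in> \<nat>" "1 \<le> M" "M \<le> N * N"
    and F0: "\<And>x. x \<in> standard_grid N \<Longrightarrow> x * N < 0 \<or> M \<le> x * N \<Longrightarrow> F x = 0"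
    and F: "\<And>x. x \<in> standard_grid N \<Longrightarrow> 0 \<le> x * N \<Longrightarrow> x * N < M \<Longrightarrow>
       \<bar>F x - c * (N * (x * N) / (M * M))\<bar> \<le> e * (N * (x * N) / (M * M))"
  shows "\<bar>(\<Sum>x\<in>standard_grid N. F x) / N - c * ((M - 1) / (2 * M))\<bar> \<le> e * ((M - 1) / (2 * M))"
proof -
  obtain m :: nat where m: "M = real m"
    using M(1) by (auto elim: Nats_cases)
  let ?x = "\<lambda>k::nat. k / N"
  \<comment> \<open>The bound \<open>M \<le> N * N\<close> keeps these points inside the
    grid.\<close>
  have grid: "?x k \<in> standard_grid N" if "k < m" for k
  proof -
    have "real k \<le> N * N"
      using that m M(3) by linarith
    then show ?thesis
      using N by (simp add: standard_grid_def pos_divide_le_eq)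
  qed
  have "(\<Sum>x\<in>standard_grid N. F x) = (\<Sum>x\<in>?x ` {..<m}. F x)"
  proof (rule sum.mono_neutral_right)
    show "finite (standard_grid N)"
      by (rule finite_standard_grid[OF N])
    show "?x ` {..<m} \<subseteq> standard_grid N"
      using grid by auto
    show "\<forall>x\<in>standard_grid N - ?x ` {..<m}. F x = 0"
    proof
      fix x
      assume x: "x \<in> standard_grid N - ?x ` {..<m}"
      then obtain k where k: "x * N = of_int k"
        by (auto simp: standard_grid_def elim: Ints_cases)
      have "x * N < 0 \<or> M \<le> x * N"
      proof (rule ccontr)
        assume *: "\<not> ?thesis"
        then have "0 \<le> k" "k < int m"
          using k m by auto
        moreover from this have "x = ?x (nat k)"
          using k N by (simp add: field_simps)
        ultimately have "x \<in> ?x ` {..<m}"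
          by (intro image_eqI[of _ _ "nat k"]) auto
        then show False
          using x by blast
      qed
      then show "F x = 0"
        using F0 x by blast
    qed
  qed
  also have "\<dots> = (\<Sum>k<m. F (?x k))"
    using N by (intro sum.reindex[unfolded o_def]) (auto simp: inj_on_def)
  finally have sum_F: "(\<Sum>x\<in>standard_grid N. F x) = (\<Sum>k<m. F (?x k))" .
  define w where "w = (\<lambda>k::nat. k / (M * M))"
  have sum_id: "(\<Sum>k<n. real k) = n * (real n - 1) / 2" for n
    by (induction n) (auto simp: field_simps)
  have sum_w: "(\<Sum>k<m. w k) = (M - 1) / (2 * M)"
    unfolding w_def sum_divide_distrib[symmetric] sum_id m[symmetric] using M(2) by simp
  have "\<bar>F (?x k) / N - c * w k\<bar> \<le> e * w k" if "k < m" for k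
  proof -
    have "\<bar>F (?x k) - c * (N * w k)\<bar> \<le> e * (N * w k)"
      using F[OF grid[OF that]] that N m by (simp add: w_def)
    then have "\<bar>F (?x k) - c * (N * w k)\<bar> / N \<le> e * (N * w k) / N"
      using N by (intro divide_right_mono) auto
    also have "\<bar>F (?x k) - c * (N * w k)\<bar> / N = \<bar>(F (?x k) - c * (N * w k)) / N\<bar>"
      using N by simp
    also have "(F (?x k) - c * (N * w k)) / N = F (?x k) / N - c * w k"
      using N by (simp add: diff_divide_distrib)
    finally show ?thesis
      using N by simp
  qed
  then have "\<bar>\<Sum>k<m. F (?x k) / N - c * w k\<bar> \<le> (\<Sum>k<m. e * w k)"
    by (intro order_trans[OF sum_abs] sum_mono) simp
  then show ?thesis
    unfolding sum_F sum_w[symmetric] by (simp add: sum_subtractf sum_divide_distrib sum_distrib_left)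
qed

text \<open>Transfer of the preceding estimate. The conditions on \<open>F\<close> become premises
  inside the formula; function variable 0 is \<open>F\<close>, and 1 is the indicator of the
  grid.\<close>

lemma grid_sum:
  fixes F :: "'a::nonstandard_reals \<Rightarrow> 'a"
  assumes F_int: "F \<in> internal" and N: "0 < N" and M: "M \<in> star_set \<nat>" "1 \<le> M" "M \<le> N * N"
    and F0: "\<And>x. x \<in> grid N \<Longrightarrow> x * N < 0 \<or> M \<le> x * N \<Longrightarrow> F x = 0"
    and F: "\<And>x. x \<in> grid N \<Longrightarrow> 0 \<le> x * N \<Longrightarrow> x * N < M \<Longrightarrow>
       \<bar>F x - c * (N * (x * N) / (M * M))\<bar> \<le> e * (N * (x * N) / (M * M))"
  shows "\<bar>eps N * hyperfinite_sum F (grid N) - c * ((M - 1) / (2 * M))\<bar> \<le> e * ((M - 1) / (2 * M))"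
proof -
  let ?bounds = "And (fm_less (tm_const 0) (Var 0)) (And (fm_in (Var 1) \<nat>)
      (And (fm_le (tm_const 1) (Var 1)) (fm_le (Var 1) (tm_mult (Var 0) (Var 0)))))"
  let ?indicator = "All_num 4 (And
      (fm_imp (fm_grid (Var 4) (Var 0)) (Equal (App 1 (Var 4)) (tm_const 1)))
      (fm_imp (Neg (fm_grid (Var 4) (Var 0))) (Equal (App 1 (Var 4)) (tm_const 0))))"
  let ?xN = "tm_mult (Var 4) (Var 0)"
  let ?w = "tm_divide (tm_mult (Var 0) ?xN) (tm_mult (Var 1) (Var 1))"
  let ?outside = "fm_imp (fm_or (fm_less ?xN (tm_const 0)) (fm_le (Var 1) ?xN))
      (Equal (App 0 (Var 4)) (tm_const 0))"
  let ?inside = "fm_imp (And (fm_le (tm_const 0) ?xN) (fm_less ?xN (Var 1)))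
      (fm_le (tm_fun abs (tm_diff (App 0 (Var 4)) (tm_mult (Var 2) ?w))) (tm_mult (Var 3) ?w))"
  let ?values = "All_num 4 (fm_imp (fm_grid (Var 4) (Var 0)) (And ?outside ?inside))"
  let ?s = "tm_divide (tm_diff (Var 1) (tm_const 1)) (tm_mult (tm_const 2) (Var 1))"
  let ?sum = "fm_le
      (tm_fun abs (tm_diff (tm_mult (tm_divide (tm_const 1) (Var 0)) (tm_sum 0 1)) (tm_mult (Var 2) ?s)))
      (tm_mult (Var 3) ?s)"
  let ?p = "fm_imp ?bounds (fm_imp ?indicator (fm_imp ?values ?sum))"
  have "sat star_op (internal :: ('a \<Rightarrow> 'a) set) (\<lambda>i. [N, M, c, e] ! i)
      (\<lambda>i. if i = 0 then F else indicator (grid N)) ?p"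
  proof (rule transferD)
    fix a :: "nat \<Rightarrow> real" and b :: "nat \<Rightarrow> real \<Rightarrow> real"
    let ?G = "standard_grid (a 0)"
    let ?sr = "(a 1 - 1) / (2 * a 1)"
    have "\<bar>1 / a 0 * (\<Sum>x | b 1 x = 1. b 0 x) - a 2 * ?sr\<bar> \<le> a 3 * ?sr"
      if bounds: "0 < a 0 \<and> a 1 \<in> \<nat> \<and> 1 \<le> a 1 \<and> a 1 \<le> a 0 * a 0"
        and ind: "\<forall>x. (x \<in> ?G \<longrightarrow> b 1 x = 1) \<and> (x \<notin> ?G \<longrightarrow> b 1 x = 0)"
        and F: "\<forall>x. x \<in> ?G \<longrightarrow> (x * a 0 < 0 \<or> a 1 \<le> x * a 0 \<longrightarrow> b 0 x = 0) \<and>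
          (0 \<le> x * a 0 \<and> x * a 0 < a 1 \<longrightarrow>
            \<bar>b 0 x - a 2 * (a 0 * (x * a 0) / (a 1 * a 1))\<bar> \<le> a 3 * (a 0 * (x * a 0) / (a 1 * a 1)))"
    proof -
      \<comment> \<open>On the standard side \<open>b 1\<close> is known only through
        \<open>?indicator\<close>, which identifies the summation set with the standard
        grid.\<close>
      have "x \<in> {x. b 1 x = 1} \<longleftrightarrow> x \<in> ?G" for x
        using spec[OF ind, of x] by (cases "x \<in> ?G") simp_all
      then have set_eq: "{x. b 1 x = 1} = ?G"
        by blast
      have "\<bar>(\<Sum>x\<in>?G. b 0 x) / a 0 - a 2 * ?sr\<bar> \<le> a 3 * ?sr"
        by (rule standard_grid_sum) (use bounds F in blast)+
      then show ?thesis
        unfolding set_eq by simp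
    qed
    then show "sat (\<lambda>G. G) UNIV a b ?p"
      by simp
  qed (use F_int internal_indicator_grid[OF N] in auto)
  moreover have "\<forall>x. x \<in> grid N \<longrightarrow> (x * N < 0 \<or> M \<le> x * N \<longrightarrow> F x = 0) \<and>
      (0 \<le> x * N \<and> x * N < M \<longrightarrow>
        \<bar>F x - c * (N * (x * N) / (M * M))\<bar> \<le> e * (N * (x * N) / (M * M)))"
    using F0 F by blast
  ultimately show ?thesis
    using N M by (simp add: eps_def)
qed

section \<open>Standard parts of grid functions\<close>

lemma star_real_less_infinite:
  fixes N :: "'a::nonstandard_reals"
  assumes "0 \<le> N" "\<not> hfinite N"
  shows "star_real r < N"
  using assms by (auto simp: hfinite_def not_le)

lemma inverse_infinite_close_0:
  fixes N :: "'a::nonstandard_reals"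
  assumes "0 \<le> N" "\<not> hfinite N"
  shows "inf_close (1 / N) 0"
  unfolding inf_close_def
proof (intro allI impI)
  fix r :: real
  assume "0 < r"
  have "0 < N"
    using star_real_less_infinite[OF assms, of 0] by simp
  have "1 / star_real r < N"
    using star_real_less_infinite[OF assms, of "1 / r"] by (simp add: star_real_divide)
  then show "\<bar>1 / N - 0\<bar> < star_real r"
    using \<open>0 < N\<close> \<open>0 < r\<close> by (simp add: field_simps)
qed

lemma inf_close_abs: "inf_close x y \<Longrightarrow> inf_close \<bar>x\<bar> \<bar>y\<bar>"
  unfolding inf_close_def by (meson abs_triangle_ineq3 le_less_trans)

text \<open>If \<open>s < r\<close>, the neighbourhoods of \<open>r\<close> and \<open>s\<close>
  with radius half the gap would be disjoint, forcing \<open>y < x\<close>.\<close>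

lemma inf_close_le:
  fixes x y :: "'a::nonstandard_reals"
  assumes "inf_close x (star_real r)" "inf_close y (star_real s)" "x \<le> y"
  shows "r \<le> s"
proof (rule ccontr)
  define e where "e = (r - s) / 2"
  assume "\<not> ?thesis"
  then have "0 < e" by (simp add: e_def)
  then have "\<bar>x - star_real r\<bar> < star_real e" "\<bar>y - star_real s\<bar> < star_real e"
    using assms unfolding inf_close_def by blast+
  moreover have "star_real r - star_real s = star_real e + (star_real e :: 'a)"
    by (simp add: e_def flip: star_real_diff star_real_add)
  ultimately show False
    using assms(3) by linarith
qed

text \<open>The slack \<open>d - \<bar>s - t\<bar>\<close> is a positive standard real and absorbs
  the infinitesimal distance from \<open>y\<close> to \<open>s\<close>.\<close>

lemma inf_close_within:
  fixes y :: "'a::nonstandard_reals"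
  assumes "inf_close y (star_real s)" "\<bar>s - t\<bar> < d"
  shows "\<bar>y - star_real t\<bar> < star_real d"
proof -
  have "\<bar>y - star_real s\<bar> < star_real (d - \<bar>s - t\<bar>)"
    using assms unfolding inf_close_def by simp
  then have "\<bar>y - star_real s\<bar> < star_real d - \<bar>star_real s - star_real t\<bar>"
    by (simp add: star_real_diff star_real_abs)
  then show ?thesis
    by linarith
qed

lemma st_part_cong: "inf_close x y \<Longrightarrow> st_part x = st_part y"
  unfolding st_part_def by (metis inf_close_sym inf_close_trans)

text \<open>The range bound of the grid amounts to \<open>\<bar>x\<bar> \<le> N\<close>, which every
  finite \<open>x\<close> satisfies.\<close>

lemma grid_memI:
  fixes N x :: "'a::nonstandard_reals"
  assumes N: "0 \<le> N" "\<not> hfinite N" and x: "hfinite x" "x * N \<in> star_set \<int>"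
  shows "x \<in> grid N"
proof -
  obtain r where r: "\<bar>x\<bar> \<le> star_real r"
    using x by (auto simp: hfinite_def)
  have "0 < N"
    using star_real_less_infinite[OF N, of 0] by simp
  moreover have "\<bar>x\<bar> \<le> N"
    using r star_real_less_infinite[OF N, of r] by linarith
  then have "\<bar>x\<bar> * N \<le> N * N"
    using N(1) by (rule mult_right_mono)
  then have "\<bar>x * N\<bar> \<le> N * N"
    using N(1) by (simp add: abs_mult)
  ultimately show ?thesis
    using x(2) by (simp add: grid_iff abs_le_iff minus_le_iff)
qed

text \<open>Rounding \<open>t * N\<close> down to a hyperinteger yields a grid point at distance at
  most \<open>1/N\<close> from \<open>t\<close>.\<close>

lemma grid_near:
  fixes N :: "'a::nonstandard_reals"
  assumes N: "0 \<le> N" "\<not> hfinite N"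
  obtains x where "x \<in> grid N" "inf_close x (star_real t)"
proof -
  have "0 < N"
    using star_real_less_infinite[OF N, of 0] by simp
  obtain n where n: "n \<in> star_set \<int>" "n \<le> star_real t * N" "star_real t * N < n + 1"
    using star_Ints_floor by blast
  have "n / N \<le> star_real t" "star_real t < n / N + 1 / N"
    using n \<open>0 < N\<close> by (simp_all add: field_simps)
  then have "\<bar>n / N - star_real t\<bar> \<le> \<bar>1 / N - 0\<bar>"
    by linarith
  then have close: "inf_close (n / N) (star_real t)"
    using inverse_infinite_close_0[OF N] unfolding inf_close_def by (meson le_less_trans)
  moreover have "n / N \<in> grid N"
    using N inf_close_hfinite[OF close] n(1) \<open>0 < N\<close> by (intro grid_memI) auto
  ultimately show thesis
    using that by blast
qed

text \<open>The condition that \<open>grid_test_functions\<close> imposes on each iterated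
  difference.\<close>

definition S_continuous :: "'a \<Rightarrow> ('a \<Rightarrow> 'a::nonstandard_reals) \<Rightarrow> bool" where
  "S_continuous N f \<longleftrightarrow>
     (\<forall>x\<in>grid N. hfinite x \<longrightarrow> hfinite (f x)) \<and>
     (\<forall>x\<in>grid N. \<forall>y\<in>grid N. hfinite x \<and> hfinite y \<and> inf_close x y \<longrightarrow> inf_close (f x) (f y))"

text \<open>S-continuity makes the standard part of the value independent of the grid point chosen
  in the monad of \<open>t\<close>, so the definite description in \<open>st_function\<close> is
  well defined.\<close>

lemma st_function_close:
  fixes N :: "'a::nonstandard_reals"
  assumes f: "S_continuous N f" and x: "x \<in> grid N" "inf_close x (star_real t)"
  shows "inf_close (f x) (star_real (st_function N f t))"
proof -
  have fin: "hfinite x"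
    using x(2) by (rule inf_close_hfinite) simp
  have "st_function N f t = st_part (f x)"
    unfolding st_function_def
  proof (rule the_equality)
    show "\<exists>y\<in>grid N. hfinite y \<and> st_part y = t \<and> st_part (f y) = st_part (f x)"
      using x fin st_part_eqI by blast
  next
    fix s
    assume "\<exists>y\<in>grid N. hfinite y \<and> st_part y = t \<and> st_part (f y) = s"
    then obtain y where y: "y \<in> grid N" "hfinite y" "st_part y = t" "st_part (f y) = s"
      by blast
    then have "inf_close y x"
      using inf_close_st_part[OF y(2)] x(2) inf_close_sym inf_close_trans by blast
    then show "s = st_part (f x)"
      using f x y fin st_part_cong unfolding S_continuous_def by blast
  qed
  moreover have "hfinite (f x)"
    using f x fin unfolding S_continuous_def by blast
  ultimately show ?thesis
    using inf_close_st_part by simp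
qed

lemma st_function_eps_delta:
  fixes N :: "'a::nonstandard_reals"
  assumes N: "0 \<le> N" "\<not> hfinite N" and f: "f \<in> internal" "S_continuous N f" and e: "0 < e"
  shows "\<exists>d>0. \<forall>y\<in>grid N. \<bar>y - star_real t\<bar> < star_real d \<longrightarrow>
    \<bar>f y - star_real (st_function N f t)\<bar> < star_real e"
proof -
  have "0 < N"
    using star_real_less_infinite[OF N, of 0] by simp
  from S_continuous_eps_delta[OF f(1) this e st_function_close[OF f(2)]] show ?thesis
    by metis
qed

lemma isCont_st_function:
  fixes N :: "'a::nonstandard_reals"
  assumes N: "0 \<le> N" "\<not> hfinite N" and f: "f \<in> internal" "S_continuous N f"
  shows "isCont (st_function N f) t"
  unfolding continuous_at_eps_delta
proof (intro allI impI)
  fix e :: real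
  assume "0 < e"
  \<comment> \<open>Half of \<open>e\<close>, since passing to standard parts leaves only a weak
    inequality.\<close>
  then obtain d where d: "0 < d"
    "\<And>y. y \<in> grid N \<Longrightarrow> \<bar>y - star_real t\<bar> < star_real d \<Longrightarrow>
       \<bar>f y - star_real (st_function N f t)\<bar> < star_real (e / 2)"
    using st_function_eps_delta[OF N f half_gt_zero] by blast
  have "dist (st_function N f s) (st_function N f t) < e" if s: "dist s t < d" for s
  proof -
    obtain y where y: "y \<in> grid N" "inf_close y (star_real s)"
      using grid_near[OF N] .
    have "inf_close \<bar>f y - star_real (st_function N f t)\<bar>
        (star_real \<bar>st_function N f s - st_function N f t\<bar>)"
      unfolding star_real_abs star_real_diff
      by (intro inf_close_abs inf_close_diff st_function_close[OF f(2) y] inf_close_refl)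
    moreover have "\<bar>f y - star_real (st_function N f t)\<bar> \<le> star_real (e / 2)"
      using d(2)[OF y(1)] inf_close_within[OF y(2)] s by (simp add: dist_real_def less_imp_le)
    ultimately have "\<bar>st_function N f s - st_function N f t\<bar> \<le> e / 2"
      using inf_close_le inf_close_refl by blast
    then show ?thesis
      using \<open>0 < e\<close> by (simp add: dist_real_def)
  qed
  then show "\<exists>d>0. \<forall>s. dist s t < d \<longrightarrow> dist (st_function N f s) (st_function N f t) < e"
    using d(1) by blast
qed

text \<open>Near \<open>t\<close> the difference quotient stays within \<open>e\<close> of its
  standard part at \<open>t\<close>. Then \<open>grid_increment\<close> bounds the error of the
  linear approximation between two grid points, and standard parts of both sides give
  differentiability.\<close>

lemma has_derivative_st_function:
  fixes N :: "'a::nonstandard_reals"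
  assumes N: "0 \<le> N" "\<not> hfinite N"
    and f: "f \<in> internal" "S_continuous N f" "S_continuous N (grid_diff N f)"
  shows "(st_function N f has_real_derivative st_function N (grid_diff N f) t) (at t)"
proof -
  let ?g = "st_function N f" and ?D = "st_function N (grid_diff N f) t"
  have "0 < N"
    using star_real_less_infinite[OF N, of 0] by simp
  have diff_int: "grid_diff N f \<in> internal"
    by (rule internal_grid_diff[OF \<open>0 < N\<close> f(1)])
  have "\<exists>d>0. \<forall>s. norm (s - t) < d \<longrightarrow> norm (?g s - ?g t - ?D * (s - t)) \<le> e * norm (s - t)"
    if "0 < e" for e
  proof -
    obtain d where d: "0 < d"
      "\<And>z. z \<in> grid N \<Longrightarrow> \<bar>z - star_real t\<bar> < star_real d \<Longrightarrow>
         \<bar>grid_diff N f z - star_real ?D\<bar> < star_real e"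
      using st_function_eps_delta[OF N diff_int f(3) \<open>0 < e\<close>] by blast
    have "\<bar>?g s - ?g t - ?D * (s - t)\<bar> \<le> e * \<bar>s - t\<bar>" if s: "\<bar>s - t\<bar> < d" for s
    proof -
      obtain x where x: "x \<in> grid N" "inf_close x (star_real t)"
        using grid_near[OF N] .
      obtain y where y: "y \<in> grid N" "inf_close y (star_real s)"
        using grid_near[OF N] .
      have near: "\<bar>x - star_real t\<bar> < star_real d" "\<bar>y - star_real t\<bar> < star_real d"
        using inf_close_within[OF x(2), of t d] inf_close_within[OF y(2) s] d(1) by simp_all
      \<comment> \<open>Everything between \<open>x\<close> and \<open>y\<close> is within
        \<open>d\<close> of \<open>t\<close>, as both end points are; \<open>min\<close> and
        \<open>max\<close> serve both orders of \<open>x\<close> and \<open>y\<close>.\<close>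
      have slope: "\<bar>grid_diff N f z - star_real ?D\<bar> \<le> star_real e"
        if "z \<in> grid N" "min x y \<le> z" "z \<le> max x y" for z
        using d(2)[OF that(1)] that near by (intro less_imp_le) (auto simp: min_def max_def split: if_splits)
      have "\<bar>f y - f x - star_real ?D * (y - x)\<bar> \<le> star_real e * \<bar>y - x\<bar>"
      proof (cases "x \<le> y")
        case True
        then show ?thesis
          using grid_increment[OF f(1) \<open>0 < N\<close> x(1) y(1) True, of "star_real ?D" "star_real e"] slope
          by simp
      next
        case False
        then have "\<bar>f x - f y - star_real ?D * (x - y)\<bar> \<le> star_real e * (x - y)"
          using grid_increment[OF f(1) \<open>0 < N\<close> y(1) x(1), of "star_real ?D" "star_real e"] slope
          by simp
        moreover have "f x - f y - star_real ?D * (x - y) = - (f y - f x - star_real ?D * (y - x))"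
          by (simp add: algebra_simps)
        ultimately show ?thesis
          using False by (metis abs_minus_cancel abs_minus_commute abs_of_pos diff_gt_0_iff_gt not_le)
      qed
      moreover have close: "inf_close (y - x) (star_real (s - t))"
        using x y by (simp add: star_real_diff inf_close_diff)
      have "inf_close \<bar>f y - f x - star_real ?D * (y - x)\<bar> (star_real \<bar>?g s - ?g t - ?D * (s - t)\<bar>)"
        unfolding star_real_abs star_real_diff[of "?g s - ?g t"] star_real_diff[of "?g s" "?g t"]
          star_real_mult
        using f(2) x y close
        by (intro inf_close_abs inf_close_diff inf_close_mult_left st_function_close hfinite_star_real)
      moreover have "inf_close (star_real e * \<bar>y - x\<bar>) (star_real (e * \<bar>s - t\<bar>))"
        unfolding star_real_abs star_real_mult
        by (intro inf_close_abs inf_close_mult_left close hfinite_star_real)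
      ultimately show ?thesis
        using inf_close_le by blast
    qed
    then show ?thesis
      using d(1) by auto
  qed
  then show ?thesis
    by (auto simp: has_field_derivative_def has_derivative_at_alt bounded_linear_mult_right)
qed

text \<open>A grid point infinitely close to \<open>t\<close> with
  \<open>\<bar>x\<bar> \<le> star_real r\<close> would force
  \<open>\<bar>t\<bar> \<le> r\<close>.\<close>

lemma st_function_eq_0:
  fixes N :: "'a::nonstandard_reals"
  assumes N: "0 \<le> N" "\<not> hfinite N" and f: "S_continuous N f"
    and supp: "\<And>x. x \<in> grid N \<Longrightarrow> x \<notin> {- star_real r..star_real r} \<Longrightarrow> f x = 0"
    and t: "r < \<bar>t\<bar>"
  shows "st_function N f t = 0"
proof -
  obtain x where x: "x \<in> grid N" "inf_close x (star_real t)"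
    using grid_near[OF N] .
  have "\<not> \<bar>x\<bar> \<le> star_real r"
    using inf_close_le[of "\<bar>x\<bar>" "\<bar>t\<bar>" "star_real r" r] inf_close_abs[OF x(2)] t
    by (auto simp: star_real_abs)
  then have "f x = 0"
    using supp[OF x(1)] by (auto simp: abs_le_iff)
  then have "inf_close (star_real 0) (star_real (st_function N f t) :: 'a)"
    using st_function_close[OF f x] by simp
  then show ?thesis
    by (simp only: inf_close_star_real_iff)
qed

section \<open>The derivative of the Heaviside function\<close>

text \<open>Stated for continuously differentiable functions instead of
  \<open>test_functions\<close>, so that a single differentiation of
  \<open>st_function N \<phi>\<close> is enough to apply it.\<close>

lemma dist_deriv_heaviside:
  assumes deriv: "\<And>x. (\<phi> has_real_derivative \<phi>' x) (at x)" and cont: "\<And>x. isCont \<phi>' x"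
    and supp: "\<And>x. r < \<bar>x\<bar> \<Longrightarrow> \<phi> x = 0"
  shows "dist_deriv (regular_distribution heaviside) \<phi> = \<phi> 0"
proof -
  \<comment> \<open>\<open>R\<close> is positive and beyond \<open>r\<close>: thus
    \<open>\<phi> R = 0\<close>, and \<open>\<phi>'\<close> vanishes to the right of
    \<open>R\<close>.\<close>
  define R where "R = \<bar>r\<bar> + 1"
  have deriv_eq: "deriv \<phi> = \<phi>'"
    using deriv by (auto intro: DERIV_imp_deriv)
  have zero: "\<phi>' x = 0" if "r < \<bar>x\<bar>" for x
  proof -
    have "open {x::real. r < \<bar>x\<bar>}"
      by (intro open_Collect_less continuous_intros)
    then have "(\<phi> has_real_derivative 0) (at x)"
      using that supp by (intro has_field_derivative_transform_within_open[OF DERIV_const]) auto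
    then show ?thesis
      using deriv DERIV_unique by blast
  qed
  have "(LINT x|lborel. heaviside x * \<phi>' x) = (LINT x|lborel. indicator {0..R} x *\<^sub>R \<phi>' x)"
  proof (rule integral_cong_AE)
    have [measurable]: "\<phi>' \<in> borel_measurable borel"
      using cont by (intro borel_measurable_continuous_onI) (simp add: continuous_at_imp_continuous_on)
    have [measurable]: "heaviside \<in> borel_measurable borel"
      unfolding heaviside_def by measurable
    show "(\<lambda>x. heaviside x * \<phi>' x) \<in> borel_measurable lborel"
      "(\<lambda>x. indicator {0..R} x *\<^sub>R \<phi>' x) \<in> borel_measurable lborel"
      by measurable
    \<comment> \<open>At 0 the function \<open>heaviside\<close> is 0 but the indicator is 1, so the
      integrands agree only almost everywhere.\<close>
    have "AE x in lborel. x \<noteq> (0::real)"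
      by (rule AE_lborel_singleton)
    then show "AE x in lborel. heaviside x * \<phi>' x = indicator {0..R} x *\<^sub>R \<phi>' x"
      by eventually_elim (auto simp: heaviside_def indicator_def R_def intro!: zero)
  qed
  also have "\<dots> = \<phi> R - \<phi> 0"
    using deriv cont
    by (intro integral_FTC_Icc)
      (auto simp: R_def has_real_derivative_iff_has_vector_derivative[symmetric]
        intro: has_field_derivative_at_within continuous_at_imp_continuous_on)
  also have "\<phi> R = 0"
    by (rule supp) (simp add: R_def)
  finally show ?thesis
    by (simp add: dist_deriv_def regular_distribution_def deriv_eq)
qed

lemma test_functionD:
  assumes "\<phi> \<in> test_functions"
  shows "(\<phi> has_real_derivative deriv \<phi> x) (at x)" "isCont (deriv \<phi>) x"
    "\<exists>r. \<forall>x. r < \<bar>x\<bar> \<longrightarrow> \<phi> x = 0"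
proof -
  have "(deriv ^^ 0) \<phi> differentiable at x" "(deriv ^^ 1) \<phi> differentiable at x"
    using assms unfolding test_functions_def by blast+
  then show "(\<phi> has_real_derivative deriv \<phi> x) (at x)" "isCont (deriv \<phi>) x"
    by (auto simp: DERIV_deriv_iff_real_differentiable differentiable_imp_continuous_within)
  show "\<exists>r. \<forall>x. r < \<bar>x\<bar> \<longrightarrow> \<phi> x = 0"
    using assms by (auto simp: test_functions_def)
qed

lemma dist_deriv_heaviside_test:
  assumes "\<phi> \<in> test_functions"
  shows "dist_deriv (regular_distribution heaviside) \<phi> = \<phi> 0"
proof -
  obtain r where "\<forall>x. r < \<bar>x\<bar> \<longrightarrow> \<phi> x = 0"
    using test_functionD(3)[OF assms] by blast
  then show ?thesis
    using dist_deriv_heaviside[OF test_functionD(1,2)[OF assms], of r] by simp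
qed

text \<open>On test functions the functional is \<open>c * \<phi> 0\<close>. Sums and multiples are
  evaluated by \<open>dist_deriv_heaviside\<close> itself, which avoids closure properties of
  \<open>test_functions\<close>.\<close>

lemma is_distribution_heaviside_deriv:
  "is_distribution (dist_scale c (dist_deriv (regular_distribution heaviside)))"
proof -
  let ?\<delta> = "dist_deriv (regular_distribution heaviside)"
  have add: "?\<delta> (\<lambda>x. \<phi> x + \<psi> x) = \<phi> 0 + \<psi> 0" 
    if test: "\<phi> \<in> test_functions" "\<psi> \<in> test_functions" for \<phi> \<psi>
  proof -
    obtain r s where supp: "\<forall>x. r < \<bar>x\<bar> \<longrightarrow> \<phi> x = 0" "\<forall>x. s < \<bar>x\<bar> \<longrightarrow> \<psi> x = 0"
      using test_functionD(3)[OF test(1)] test_functionD(3)[OF test(2)] by blast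
    show ?thesis
      by (rule dist_deriv_heaviside[where \<phi>' = "\<lambda>x. deriv \<phi> x + deriv \<psi> x" and r = "max r s"])
        (use test supp in \<open>auto intro!: derivative_eq_intros test_functionD continuous_intros\<close>)
  qed
  have scale: "?\<delta> (\<lambda>x. k * \<phi> x) = k * \<phi> 0" if test: "\<phi> \<in> test_functions" for \<phi> k
  proof -
    obtain r where supp: "\<forall>x. r < \<bar>x\<bar> \<longrightarrow> \<phi> x = 0"
      using test_functionD(3)[OF test] by blast
    show ?thesis
      by (rule dist_deriv_heaviside[where \<phi>' = "\<lambda>x. k * deriv \<phi> x" and r = r])
        (use test supp in \<open>auto intro!: DERIV_cmult test_functionD continuous_intros\<close>)
  qed
  have lim: "(\<lambda>k. \<phi>s k 0) \<longlonglongrightarrow> \<phi> 0" if "test_converges \<phi>s \<phi>" for \<phi>s \<phi>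
  proof -
    have "uniform_limit UNIV (\<lambda>k. (deriv ^^ 0) (\<phi>s k)) ((deriv ^^ 0) \<phi>) sequentially"
      using that unfolding test_converges_def by blast
    then show ?thesis
      by (auto dest: tendsto_uniform_limitI)
  qed
  show ?thesis
    unfolding is_distribution_def dist_scale_def
  proof (intro conjI ballI allI impI)
    fix \<phi> \<psi>
    assume "\<phi> \<in> test_functions" "\<psi> \<in> test_functions"
    then show "c * ?\<delta> (\<lambda>x. \<phi> x + \<psi> x) = c * ?\<delta> \<phi> + c * ?\<delta> \<psi>"
      by (simp add: add dist_deriv_heaviside_test algebra_simps)
  next
    fix \<phi> and k :: real
    assume "\<phi> \<in> test_functions"
    then show "c * ?\<delta> (\<lambda>x. k * \<phi> x) = k * (c * ?\<delta> \<phi>)"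
      by (simp add: scale dist_deriv_heaviside_test)
  next
    fix \<phi>s \<phi>
    assume "\<phi> \<in> test_functions" "(\<forall>k. \<phi>s k \<in> test_functions) \<and> test_converges \<phi>s \<phi>"
    then show "(\<lambda>k. c * ?\<delta> (\<phi>s k)) \<longlonglongrightarrow> c * ?\<delta> \<phi>"
      by (simp add: dist_deriv_heaviside_test lim tendsto_mult_left)
  qed
qed

section \<open>The product of the ramp with its difference quotient\<close>

text \<open>Ensures that at finite points the zero convention of \<open>grid_diff\<close> beyond the
  right end of the grid does not interfere.\<close>

lemma grid_succ:
  fixes N x :: "'a::nonstandard_reals"
  assumes N: "0 \<le> N" "\<not> hfinite N" and x: "x \<in> grid N" "hfinite x"
  shows "x + eps N \<in> grid N"
proof (rule grid_memI[OF N])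
  have "0 < N"
    using star_real_less_infinite[OF N, of 0] by simp
  have "hfinite (eps N)"
    using inf_close_hfinite[OF inverse_infinite_close_0[OF N]] by (simp add: eps_def)
  with x(2) show "hfinite (x + eps N)"
    by (rule hfinite_add)
  have "(x + eps N) * N = x * N + star_real 1"
    using \<open>0 < N\<close> by (simp add: eps_def distrib_right)
  moreover have "star_real 1 \<in> star_set \<int>"
    by (rule star_real_mem_star_set) simp
  moreover have "x * N \<in> star_set \<int>"
    using x(1) \<open>0 < N\<close> by (simp add: grid_iff)
  ultimately show "(x + eps N) * N \<in> star_set \<int>"
    using star_Ints_closed(1)[of "x * N" "star_real 1"] by simp
qed

locale ramp =
  fixes N M :: "'a::nonstandard_reals" and h :: "'a \<Rightarrow> 'a"
  assumes N: "0 \<le> N" "\<not> hfinite N"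
    and M: "M \<in> star_set \<nat>" "M \<notin> star_real ` \<nat>" "inf_close (M * eps N) 0"
    and h_grid: "h \<in> grid_functions N"
    and h_neg: "x \<in> grid N \<Longrightarrow> x \<le> 0 \<Longrightarrow> h x = 0"
    and h_mid: "x \<in> grid N \<Longrightarrow> 0 < x \<Longrightarrow> x < M * eps N \<Longrightarrow> h x = x / (M * eps N)"
    and h_pos: "x \<in> grid N \<Longrightarrow> x \<ge> M * eps N \<Longrightarrow> h x = 1"
begin

lemma N_pos: "0 < N"
  using star_real_less_infinite[OF N, of 0] by simp

lemma M_infinite: "0 \<le> M" "\<not> hfinite M"
  using M star_Nats_nonneg star_Nats_hfinite by blast+

lemma M_pos: "0 < M" and M_ge_1: "1 \<le> M"
  using star_real_less_infinite[OF M_infinite, of 0] star_real_less_infinite[OF M_infinite, of 1]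
  by simp_all

text \<open>\<open>M * eps N < 1\<close> gives \<open>M < N\<close>, so the ramp fits into the grid
  as \<open>grid_sum\<close> requires.\<close>

lemma M_le: "M \<le> N * N"
proof -
  have "\<bar>M * eps N - 0\<bar> < star_real 1"
    using M(3) zero_less_one unfolding inf_close_def by blast
  then have "M < N"
    using N_pos M_pos by (simp add: eps_def)
  also have "1 \<le> N"
    using star_real_less_infinite[OF N, of 1] by simp
  then have "N \<le> N * N"
    using N_pos by simp
  finally show ?thesis
    by simp
qed

text \<open>Merges the three clauses for \<open>h\<close>. The end \<open>x * N = M\<close> is
  included because the forward difference at the last point below it looks there.\<close>

lemma h_ramp:
  assumes "x \<in> grid N" "0 \<le> x * N" "x * N \<le> M"
  shows "h x = x * N / M"
proof -
  have "0 \<le> x"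
    using assms(2) N_pos by (simp add: zero_le_mult_iff)
  consider "x = 0" | "0 < x" "x * N < M" | "x * N = M"
    using \<open>0 \<le> x\<close> assms(3) by fastforce
  then show ?thesis
  proof cases
    case 1
    then show ?thesis
      using h_neg[OF assms(1)] by simp
  next
    case 2
    then show ?thesis
      using h_mid[OF assms(1)] N_pos by (simp add: eps_def field_simps)
  next
    case 3
    then show ?thesis
      using h_pos[OF assms(1)] N_pos M_pos by (simp add: eps_def field_simps)
  qed
qed

lemma ramp_product_inside:
  assumes x: "x \<in> grid N" "0 \<le> x * N" "x * N < M"
  shows "h x * grid_diff N h x = N * (x * N) / (M * M)"
proof -
  have "0 \<le> x"
    using x(2) N_pos by (simp add: zero_le_mult_iff)
  have "x < M * eps N"
    using x(3) N_pos by (simp add: eps_def field_simps)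
  then have "inf_close x 0"
    using M(3) \<open>0 \<le> x\<close> unfolding inf_close_def by fastforce
  then have "hfinite x"
    using inf_close_hfinite hfinite_0 by blast
  then have succ: "x + eps N \<in> grid N"
    using grid_succ N x(1) by blast
  have succ_N: "(x + eps N) * N = x * N + 1"
    using N_pos by (simp add: eps_def distrib_right)
  \<comment> \<open>By discreteness of the hyperintegers the successor does not jump past the top of
    the ramp, so \<open>h_ramp\<close> still applies to it.\<close>
  have "x * N + 1 \<le> M"
    using x M(1) star_Nats_subset_Ints N_pos by (intro star_Ints_closed(2)) (auto simp: grid_iff)
  then have "h (x + eps N) = (x * N + 1) / M"
    using h_ramp[OF succ] succ_N x(2) by simp
  moreover have "h x = x * N / M"
    using h_ramp x by simp
  ultimately have "grid_diff N h x = N / M"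
    using x(1) by (simp add: grid_diff_def eps_def flip: diff_divide_distrib)
  with \<open>h x = x * N / M\<close> show ?thesis
    by (simp add: mult_ac)
qed

text \<open>To the left \<open>h x\<close> is 0; from the top on, \<open>h\<close> is 1 at
  \<open>x\<close> and at its successor. The bound \<open>r\<close> makes \<open>x\<close> finite
  there, away from the right end of the grid, where the difference would drop to the default
  0.\<close>

lemma ramp_product_outside:
  assumes x: "x \<in> grid N" "x * N < 0 \<or> M \<le> x * N" "x \<le> star_real r"
  shows "h x * grid_diff N h x = 0"
proof (cases "x * N < 0")
  case True
  then have "x \<le> 0"
    using N_pos by (simp add: mult_less_0_iff)
  then show ?thesis
    using h_neg x(1) by simp
next
  case False
  then have "M * eps N \<le> x"
    using x(2) N_pos by (simp add: eps_def field_simps)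
  moreover have "0 \<le> M * eps N" "0 \<le> eps N"
    using M_pos N_pos by (simp_all add: eps_def)
  ultimately have "\<bar>x\<bar> \<le> star_real r" "M * eps N \<le> x + eps N"
    using x(3) by simp_all
  then have "h (x + eps N) = 1"
    using x(1) N by (intro h_pos grid_succ) (auto simp: hfinite_def)
  moreover have "h x = 1"
    using h_pos x(1) \<open>M * eps N \<le> x\<close> by blast
  ultimately show ?thesis
    by (simp add: grid_diff_def)
qed

lemma ramp_product_grid_function: "(\<lambda>x. h x * grid_diff N h x) \<in> grid_functions N"
  using h_grid internal_mult[OF _ internal_grid_diff[OF N_pos]]
  by (simp add: grid_functions_def)

text \<open>The quotient equals \<open>1/2 - 1/(2 * M)\<close>, and \<open>M\<close> is
  infinite.\<close>

lemma half_sum_close: "inf_close ((M - 1) / (2 * M)) (star_real (1 / 2))"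
proof -
  have "inf_close (star_real (1 / 2) - star_real (1 / 2) * (1 / M)) (star_real (1 / 2) - star_real (1 / 2) * 0)"
    by (intro inf_close_diff inf_close_refl inf_close_mult_left hfinite_star_real
        inverse_infinite_close_0 M_infinite)
  moreover have "star_real (1 / 2) - star_real (1 / 2) * (1 / M) = (M - 1) / (2 * M)"
    using M_pos by (simp add: star_real_divide field_simps)
  ultimately show ?thesis
    by simp
qed

text \<open>The product of \<open>h\<close> with its difference supplies exactly the weights of
  \<open>grid_sum\<close>, and on the ramp \<open>\<phi>\<close> is within every standard
  \<open>e\<close> of \<open>?c\<close>. So the inner product is close to \<open>?c * ?s\<close>,
  and \<open>?s\<close> is close to \<open>1/2\<close>.\<close>

lemma inner_ramp_product_close:
  assumes \<phi>: "\<phi> \<in> internal" "S_continuous N \<phi>"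
    and supp: "\<And>x. x \<in> grid N \<Longrightarrow> x \<notin> {- star_real r..star_real r} \<Longrightarrow> \<phi> x = 0"
  shows "inf_close (grid_inner N (\<lambda>x. h x * grid_diff N h x) \<phi>)
    (star_real (st_function N \<phi> 0 / 2))"
proof -
  let ?c = "star_real (st_function N \<phi> 0)" and ?s = "(M - 1) / (2 * M)"
  let ?F = "\<lambda>x. h x * grid_diff N h x * \<phi> x"
  have "inf_close (grid_inner N (\<lambda>x. h x * grid_diff N h x) \<phi>) (?c * ?s)"
    unfolding inf_close_def
  proof (intro allI impI)
    fix e :: real
    assume "0 < e"
    then obtain d where d: "0 < d"
      "\<forall>x\<in>grid N. \<bar>x - star_real 0\<bar> < star_real d \<longrightarrow> \<bar>\<phi> x - ?c\<bar> < star_real e"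
      using st_function_eps_delta[OF N \<phi>] by blast
    have "\<bar>eps N * hyperfinite_sum ?F (grid N) - ?c * ?s\<bar> \<le> star_real e * ?s"
    proof (rule grid_sum[OF _ N_pos M(1) M_ge_1 M_le])
      show "?F \<in> internal"
        using internal_mult[OF _ \<phi>(1)] ramp_product_grid_function by (simp add: grid_functions_def)
    next
      fix x
      assume "x \<in> grid N" "x * N < 0 \<or> M \<le> x * N"
      \<comment> \<open>Up to \<open>r\<close> the ramp product vanishes, beyond \<open>r\<close>
        the factor \<open>\<phi>\<close> does.\<close>
      then show "?F x = 0"
        using ramp_product_outside[of x r] supp[of x] by (cases "x \<le> star_real r") auto
    next
      fix x
      assume x: "x \<in> grid N" "0 \<le> x * N" "x * N < M"
      let ?w = "N * (x * N) / (M * M)"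
      have "0 \<le> ?w"
        using x N_pos by simp
      have "0 \<le> x" "x < M * eps N"
        using x N_pos by (simp_all add: zero_le_mult_iff eps_def field_simps)
      \<comment> \<open>The whole ramp lies in the monad of 0, hence within the standard distance
        \<open>d\<close>.\<close>
      moreover have "\<bar>M * eps N - 0\<bar> < star_real d"
        using M(3) d(1) unfolding inf_close_def by blast
      ultimately have "\<bar>x - star_real 0\<bar> < star_real d"
        by simp
      then have "\<bar>\<phi> x - ?c\<bar> \<le> star_real e"
        using d(2) x(1) by (simp add: less_imp_le)
      then have "?w * \<bar>\<phi> x - ?c\<bar> \<le> ?w * star_real e"
        using \<open>0 \<le> ?w\<close> by (rule mult_left_mono)
      moreover have "?w * \<bar>\<phi> x - ?c\<bar> = \<bar>?F x - ?c * ?w\<bar>"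
        unfolding ramp_product_inside[OF x] using \<open>0 \<le> ?w\<close>
        by (metis abs_mult abs_of_nonneg mult.commute right_diff_distrib)
      ultimately show "\<bar>?F x - ?c * ?w\<bar> \<le> star_real e * ?w"
        by (simp only: mult.commute)
    qed
    also have "?s < 1"
      using M_pos by (simp add: divide_less_eq)
    then have "star_real e * ?s < star_real e * 1"
      using \<open>0 < e\<close> by (intro mult_strict_left_mono) simp_all
    then have "star_real e * ?s < star_real e"
      by simp
    finally show "\<bar>grid_inner N (\<lambda>x. h x * grid_diff N h x) \<phi> - ?c * ?s\<bar> < star_real e"
      by (simp add: grid_inner_def)
  qed
  moreover have "inf_close (?c * ?s) (?c * star_real (1 / 2))"
    by (intro inf_close_mult_left half_sum_close hfinite_star_real)
  moreover have "?c * star_real (1 / 2) = star_real (st_function N \<phi> 0 / 2)"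
    by (simp flip: star_real_mult)
  ultimately show ?thesis
    using inf_close_trans by metis
qed

lemma ramp_product_represents:
  "represents N (\<lambda>x. h x * grid_diff N h x)
     (dist_scale (1/2) (dist_deriv (regular_distribution heaviside)))"
  unfolding represents_def
proof (intro conjI ballI ramp_product_grid_function is_distribution_heaviside_deriv)
  fix \<phi>
  assume \<phi>: "\<phi> \<in> grid_test_functions N"
  let ?\<psi> = "st_function N \<phi>"
  have int: "\<phi> \<in> internal"
    using \<phi> by (simp add: grid_test_functions_def grid_functions_def)
  obtain r where supp: "\<And>x. x \<in> grid N \<Longrightarrow> x \<notin> {- star_real r..star_real r} \<Longrightarrow> \<phi> x = 0"
    using \<phi> unfolding grid_test_functions_def by blast
  have "S_continuous N ((grid_diff N ^^ n) \<phi>)" for n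
    using \<phi> unfolding grid_test_functions_def S_continuous_def by blast
  \<comment> \<open>Order 0 makes \<open>?\<psi>\<close> well defined; order 1 provides its
    derivative and the continuity of that derivative.\<close>
  from this[of 0] this[of 1] have cont: "S_continuous N \<phi>" "S_continuous N (grid_diff N \<phi>)"
    by simp_all
  have close: "inf_close (grid_inner N (\<lambda>x. h x * grid_diff N h x) \<phi>) (star_real (?\<psi> 0 / 2))"
    by (rule inner_ramp_product_close[OF int cont(1) supp])
  then show "hfinite (grid_inner N (\<lambda>x. h x * grid_diff N h x) \<phi>)"
    by (rule inf_close_hfinite) simp
  have "dist_deriv (regular_distribution heaviside) ?\<psi> = ?\<psi> 0"
  proof (rule dist_deriv_heaviside)
    show "(?\<psi> has_real_derivative st_function N (grid_diff N \<phi>) t) (at t)" for t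
      by (rule has_derivative_st_function[OF N int cont])
    show "isCont (st_function N (grid_diff N \<phi>)) t" for t
      by (rule isCont_st_function[OF N internal_grid_diff[OF N_pos int] cont(2)])
    show "?\<psi> t = 0" if "r < \<bar>t\<bar>" for t
      by (rule st_function_eq_0[OF N cont(1) supp that])
  qed
  then show "st_part (grid_inner N (\<lambda>x. h x * grid_diff N h x) \<phi>) =
      dist_scale (1/2) (dist_deriv (regular_distribution heaviside)) ?\<psi>"
    using st_part_eqI[OF close] by (simp add: dist_scale_def)
qed

end

theorem corollary6p2:
  fixes N0 N M :: "'a::nonstandard_reals" and h :: "'a \<Rightarrow> 'a"
  assumes N0: "N0 \<in> star_set \<nat>" "\<not> hfinite N0"
    and N: "N = star_fact N0"
    and M: "M \<in> star_set \<nat>" "M \<notin> star_real ` \<nat>" "inf_close (M * eps N) 0"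
    and h: "h \<in> grid_functions N"
    and h_neg: "\<And>x. x \<in> grid N \<Longrightarrow> x \<le> 0 \<Longrightarrow> h x = 0"
    and h_mid: "\<And>x. x \<in> grid N \<Longrightarrow> 0 < x \<Longrightarrow> x < M * eps N \<Longrightarrow> h x = x / (M * eps N)"
    and h_pos: "\<And>x. x \<in> grid N \<Longrightarrow> x \<ge> M * eps N \<Longrightarrow> h x = 1"
  shows "represents N (\<lambda>x. h x * grid_diff N h x)
           (dist_scale (1/2) (dist_deriv (regular_distribution heaviside)))
       \<and> dist_eq (dist_deriv (regular_distribution heaviside)) (dirac 0)"
proof
  have le: "0 \<le> N0" "N0 \<le> N"
    using N0(1) star_Nats_nonneg star_fact_ge N by auto
  moreover have "\<not> hfinite N"
  proof
    assume "hfinite N"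
    then obtain r where "\<bar>N\<bar> \<le> star_real r"
      by (auto simp: hfinite_def)
    then have "\<bar>N0\<bar> \<le> star_real r"
      using le by simp
    then show False
      using N0(2) by (auto simp: hfinite_def)
  qed
  ultimately interpret ramp N M h
    using M h h_neg h_mid h_pos by unfold_locales auto
  show "represents N (\<lambda>x. h x * grid_diff N h x)
      (dist_scale (1/2) (dist_deriv (regular_distribution heaviside)))"
    by (rule ramp_product_represents)
  show "dist_eq (dist_deriv (regular_distribution heaviside)) (dirac 0)"
    by (simp add: dist_eq_def dirac_def dist_deriv_heaviside_test)
qed

end
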